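(* The minimal representations of unitary operators on separable Hilbert spaces are five-diagonal. That is: every unitary operator on a separable complex Hilbert space has a five-diagonal representation, but not every unitary operator on a separable complex Hilbert space has a four-diagonal representation.
   Context: Matrices are complex and either finite square or infinite with rows and columns indexed by $\mathbb{N}=\{1,2,\dots\}$. A matrix $(c_{i,j})$ is $(p,q)$-diagonal if $c_{i,j}=0$ whenever $i-j>p$ or $j-i>q$. A matrix is called $n$-diagonal if it is $([\frac n2],[\frac{n-1}2])$-diagonal or $([\frac{n-1}2],[\frac n2])$-diagonal, where $[\cdot]$ is the integer part; thus five-diagonal means $(2,2)$-diagonal, and four-diagonal means $(2,1)$-diagonal or $(1,2)$-diagonal. An operator has an $n$-diagonal representation if it is unitarily equivalent to a (finite or countably infinite) orthogonal sum of operators, each given by an $n$-diagonal matrix (finite, acting on $\mathbb{C}^N$, or infinite, acting on $\ell^2(\mathbb{N})$) with respect to the canonical orthonormal basis. If every operator of a class has an $n$-diagonal representation but not all of them have an $(n-1)$-diagonal one, the $n$-diagonal representations are called the minimal representations of the class. *)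

theory Defs
  imports "HOL-Analysis.Analysis" "HOL-Library.Function_Algebras"
begin

text \<open>
  A Hilbert space is presented as a linear subspace \<open>hcarrier H\<close> of a complex vector space in the
  sense of the locale \<^locale>\<open>vector_space\<close>; vector addition is that of the ambient type.
  Functions are added pointwise (instances from \<^theory>\<open>HOL-Library.Function_Algebras\<close>), so
  that spaces of square-summable families live inside a function type.  Values of \<open>hinner H\<close>, and of
  operators on \<open>H\<close>, are irrelevant outside \<open>hcarrier H\<close>.

  Every separable Hilbert space is isomorphic to one inside the type \<open>nat \<Rightarrow> complex\<close>, so an
  existence claim over all separable Hilbert spaces can be stated for that type.
\<close>

record 'v hilbert =
  hcarrier :: "'v set"
  hscale :: "complex \<Rightarrow> 'v \<Rightarrow> 'v"
  hinner :: "'v \<Rightarrow> 'v \<Rightarrow> complex"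

definition hnorm :: "'v hilbert \<Rightarrow> 'v \<Rightarrow> real" where
  "hnorm H x = sqrt (Re (hinner H x x))"

locale complex_hilbert_space = vector_space "hscale H" for H :: "'v::ab_group_add hilbert" +
  assumes subspace_carrier: "subspace (hcarrier H)"
    and inner_add_left: "\<lbrakk>x \<in> hcarrier H; y \<in> hcarrier H; z \<in> hcarrier H\<rbrakk>
          \<Longrightarrow> hinner H (x + y) z = hinner H x z + hinner H y z"
    and inner_scale_left: "\<lbrakk>x \<in> hcarrier H; y \<in> hcarrier H\<rbrakk>
          \<Longrightarrow> hinner H (hscale H c x) y = c * hinner H x y"
    and inner_commute: "\<lbrakk>x \<in> hcarrier H; y \<in> hcarrier H\<rbrakk>
          \<Longrightarrow> hinner H y x = cnj (hinner H x y)"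
    and inner_pos: "\<lbrakk>x \<in> hcarrier H; x \<noteq> 0\<rbrakk> \<Longrightarrow> 0 < Re (hinner H x x)"
    and complete: "\<lbrakk>\<And>n. s n \<in> hcarrier H;
          \<forall>e>0. \<exists>N. \<forall>m\<ge>N. \<forall>n\<ge>N. hnorm H (s m - s n) < e\<rbrakk>
          \<Longrightarrow> \<exists>x\<in>hcarrier H. (\<lambda>n. hnorm H (s n - x)) \<longlonglongrightarrow> 0"

definition separable_hilbert :: "'v::ab_group_add hilbert \<Rightarrow> bool" where
  "separable_hilbert H \<longleftrightarrow>
     (\<exists>D. countable D \<and> D \<subseteq> hcarrier H \<and> (\<forall>x\<in>hcarrier H. \<forall>e>0. \<exists>d\<in>D. hnorm H (x - d) < e))"

definition linear_map_on ::
    "'v::ab_group_add hilbert \<Rightarrow> 'w::ab_group_add hilbert \<Rightarrow> ('v \<Rightarrow> 'w) \<Rightarrow> bool" where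
  "linear_map_on H K T \<longleftrightarrow>
     (\<forall>x\<in>hcarrier H. T x \<in> hcarrier K) \<and>
     (\<forall>x\<in>hcarrier H. \<forall>y\<in>hcarrier H. T (x + y) = T x + T y) \<and>
     (\<forall>c. \<forall>x\<in>hcarrier H. T (hscale H c x) = hscale K c (T x))"

definition bounded_operator :: "'v::ab_group_add hilbert \<Rightarrow> ('v \<Rightarrow> 'v) \<Rightarrow> bool" where
  "bounded_operator H T \<longleftrightarrow>
     linear_map_on H H T \<and> (\<exists>B. \<forall>x\<in>hcarrier H. hnorm H (T x) \<le> B * hnorm H x)"

definition unitary_map ::
    "'v::ab_group_add hilbert \<Rightarrow> 'w::ab_group_add hilbert \<Rightarrow> ('v \<Rightarrow> 'w) \<Rightarrow> bool" where
  "unitary_map H K V \<longleftrightarrow>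
     linear_map_on H K V \<and> V ` hcarrier H = hcarrier K \<and>
     (\<forall>x\<in>hcarrier H. \<forall>y\<in>hcarrier H. hinner K (V x) (V y) = hinner H x y)"

abbreviation unitary_operator :: "'v::ab_group_add hilbert \<Rightarrow> ('v \<Rightarrow> 'v) \<Rightarrow> bool" where
  "unitary_operator H U \<equiv> unitary_map H H U"

definition unitarily_equivalent ::
    "'v::ab_group_add hilbert \<Rightarrow> ('v \<Rightarrow> 'v) \<Rightarrow> 'w::ab_group_add hilbert \<Rightarrow> ('w \<Rightarrow> 'w) \<Rightarrow> bool" where
  "unitarily_equivalent H S K T \<longleftrightarrow>
     (\<exists>V. unitary_map H K V \<and> (\<forall>x\<in>hcarrier H. V (S x) = T (V x)))"

text \<open>For \<open>I = {1..N}\<close> the following is \<open>\<complex>\<^sup>N\<close>.\<close>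

definition ell2 :: "'i set \<Rightarrow> ('i \<Rightarrow> complex) hilbert" where
  "ell2 I = \<lparr>hcarrier = {x. (\<forall>i. i \<notin> I \<longrightarrow> x i = 0) \<and> (\<lambda>i. (cmod (x i))\<^sup>2) summable_on I},
             hscale = (\<lambda>c x i. c * x i),
             hinner = (\<lambda>x y. \<Sum>\<^sub>\<infinity>i\<in>I. x i * cnj (y i))\<rparr>"

definition canonical_vec :: "'i \<Rightarrow> 'i \<Rightarrow> complex" where
  "canonical_vec j = (\<lambda>i. if i = j then 1 else 0)"

definition hilbert_sum :: "'j set \<Rightarrow> ('j \<Rightarrow> 'v::ab_group_add hilbert) \<Rightarrow> ('j \<Rightarrow> 'v) hilbert" where
  "hilbert_sum J H =
     \<lparr>hcarrier = {x. (\<forall>j\<in>J. x j \<in> hcarrier (H j)) \<and> (\<forall>j. j \<notin> J \<longrightarrow> x j = 0) \<and>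
                     (\<lambda>j. (hnorm (H j) (x j))\<^sup>2) summable_on J},
      hscale = (\<lambda>c x j. hscale (H j) c (x j)),
      hinner = (\<lambda>x y. \<Sum>\<^sub>\<infinity>j\<in>J. hinner (H j) (x j) (y j))\<rparr>"

definition operator_sum :: "'j set \<Rightarrow> ('j \<Rightarrow> 'v \<Rightarrow> 'v) \<Rightarrow> ('j \<Rightarrow> 'v::ab_group_add) \<Rightarrow> 'j \<Rightarrow> 'v" where
  "operator_sum J A x = (\<lambda>j. if j \<in> J then A j (x j) else 0)"

text \<open>
  A matrix is a function \<open>c :: nat \<Rightarrow> nat \<Rightarrow> complex\<close> together with the set \<open>I\<close> of its row and column
  indices; entries outside \<open>I\<close> are irrelevant.
\<close>

definition matrix_index_set :: "nat set \<Rightarrow> bool" where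
  "matrix_index_set I \<longleftrightarrow> I = {1..} \<or> (\<exists>N\<ge>1. I = {1..N})"

definition pq_diagonal :: "nat \<Rightarrow> nat \<Rightarrow> nat set \<Rightarrow> (nat \<Rightarrow> nat \<Rightarrow> complex) \<Rightarrow> bool" where
  "pq_diagonal p q I c \<longleftrightarrow>
     (\<forall>i\<in>I. \<forall>j\<in>I. int i - int j > int p \<or> int j - int i > int q \<longrightarrow> c i j = 0)"

definition n_diagonal :: "nat \<Rightarrow> nat set \<Rightarrow> (nat \<Rightarrow> nat \<Rightarrow> complex) \<Rightarrow> bool" where
  "n_diagonal n I c \<longleftrightarrow>
     pq_diagonal (n div 2) ((n - 1) div 2) I c \<or> pq_diagonal ((n - 1) div 2) (n div 2) I c"

definition given_by_matrix ::
    "nat set \<Rightarrow> (nat \<Rightarrow> nat \<Rightarrow> complex) \<Rightarrow> ((nat \<Rightarrow> complex) \<Rightarrow> (nat \<Rightarrow> complex)) \<Rightarrow> bool" where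
  "given_by_matrix I c A \<longleftrightarrow>
     bounded_operator (ell2 I) A \<and>
     (\<forall>i\<in>I. \<forall>j\<in>I. hinner (ell2 I) (A (canonical_vec j)) (canonical_vec i) = c i j)"

text \<open>
  Countable orthogonal sums are indexed by an arbitrary set \<open>J\<close> of natural numbers.  The empty sum
  is allowed; it represents the operator on the zero space, since matrices have positive size.
\<close>

definition has_n_diagonal_representation ::
    "nat \<Rightarrow> 'v::ab_group_add hilbert \<Rightarrow> ('v \<Rightarrow> 'v) \<Rightarrow> bool" where
  "has_n_diagonal_representation n H T \<longleftrightarrow>
     (\<exists>(J::nat set) (I :: nat \<Rightarrow> nat set) (A :: nat \<Rightarrow> (nat \<Rightarrow> complex) \<Rightarrow> (nat \<Rightarrow> complex)).
        (\<forall>j\<in>J. matrix_index_set (I j) \<and> (\<exists>c. n_diagonal n (I j) c \<and> given_by_matrix (I j) c (A j))) \<and>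
        unitarily_equivalent H T (hilbert_sum J (\<lambda>j. ell2 (I j))) (operator_sum J A))"

end

theory Submission
  imports Defs
begin

text \<open>
  Existence: by Zorn's lemma \<open>H\<close> has a maximal family of unit vectors with pairwise orthogonal
  \<open>U\<close>-orbits, countable by separability.  For each member \<open>v\<close> apply Gram-Schmidt to
  \<open>v, U v, U\<^sup>-\<^sup>1 v, U\<^sup>2 v, U\<^sup>-\<^sup>2 v, \<dots>\<close> (the CMV basis).  As \<open>U\<close> and \<open>U\<^sup>-\<^sup>1\<close> both map the span of the
  first \<open>n\<close> of these vectors into that of the first \<open>n + 2\<close>, the matrix of \<open>U\<close> is five-diagonal.

  Optimality: the bilateral shift has no nonzero finite-dimensional invariant subspace.  A unitary
  (1,2)-diagonal matrix always has one: a zero on the subdiagonal splits off an invariant finite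
  block, and orthogonality of rows and columns shows that an infinite such matrix must have a zero
  there.  The (2,1)-diagonal case follows by passing to the inverse of the shift.
\<close>

section \<open>Orthonormal families in a Hilbert space\<close>

text \<open>Powers of \<open>U\<close> in one direction only would give a Hessenberg matrix and a
  span that the inverse can leave. With both directions interleaved, each operator controls one half
  of the band: \<open>U\<close> the entries below the diagonal and, through the adjoint relation,
  its inverse those above. Two places on each side and the diagonal make five. Closed cyclic
  subspaces are never formed: completeness of a basis is expressed by a trivial orthogonal
  complement, and the blocks of \<open>U\<close> act on coordinate families. For optimality the
  column relations alone do not suffice: the unilateral shift is an isometry with a (1,2)-diagonal
  matrix and no zero on the subdiagonal. The row relations, which say that the inverse is isometric
  too, settle the first row, and the contradiction arises there.\<close>

lemma square_summable_mult:
  fixes f g :: "'i \<Rightarrow> complex"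
  assumes "(\<lambda>i. (cmod (f i))\<^sup>2) summable_on K" "(\<lambda>i. (cmod (g i))\<^sup>2) summable_on K"
  shows "(\<lambda>i. f i * g i) summable_on K"
proof -
  have "(\<lambda>i. norm (f i * g i)) summable_on K"
    by (rule abs_summable_product) (use assms in \<open>simp_all add: norm_mult power2_eq_square\<close>)
  thus ?thesis by (rule abs_summable_summable)
qed

context complex_hilbert_space
begin

abbreviation carr where "carr \<equiv> hcarrier H"
abbreviation sc (infixr "*\<^sub>H" 75) where "sc \<equiv> hscale H"
abbreviation ip where "ip \<equiv> hinner H"
abbreviation nm where "nm \<equiv> hnorm H"

lemma zero_mem [simp]: "0 \<in> carr"
  using subspace_carrier by (rule subspace_0)
lemma add_mem [simp]: "x \<in> carr \<Longrightarrow> y \<in> carr \<Longrightarrow> x + y \<in> carr"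
  using subspace_carrier by (rule subspace_add)
lemma scale_mem [simp]: "x \<in> carr \<Longrightarrow> c *\<^sub>H x \<in> carr"
  using subspace_carrier by (rule subspace_scale)
lemma diff_mem [simp]: "x \<in> carr \<Longrightarrow> y \<in> carr \<Longrightarrow> x - y \<in> carr"
  using subspace_carrier by (rule subspace_diff)
lemma sum_mem [simp]: "(\<And>i. i \<in> F \<Longrightarrow> f i \<in> carr) \<Longrightarrow> sum f F \<in> carr"
  using subspace_carrier by (rule subspace_sum)
lemma span_mem: "B \<subseteq> carr \<Longrightarrow> x \<in> span B \<Longrightarrow> x \<in> carr"
  using span_minimal[OF _ subspace_carrier] by blast

lemma ip_zero_left [simp]: "y \<in> carr \<Longrightarrow> ip 0 y = 0"
  using inner_scale_left[of 0 y 0] by simp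
lemma ip_zero_right [simp]: "y \<in> carr \<Longrightarrow> ip y 0 = 0"
  using inner_commute[of 0 y] by simp
lemma ip_add_right: "x \<in> carr \<Longrightarrow> y \<in> carr \<Longrightarrow> z \<in> carr \<Longrightarrow> ip z (x + y) = ip z x + ip z y"
  using inner_commute[of "x + y" z] inner_commute[of x z] inner_commute[of y z]
    inner_add_left[of x y z] by simp
lemma ip_scale_right: "x \<in> carr \<Longrightarrow> y \<in> carr \<Longrightarrow> ip y (c *\<^sub>H x) = cnj c * ip y x"
  using inner_commute[of "c *\<^sub>H x" y] inner_commute[of x y] inner_scale_left[of x y c] by simp
lemma ip_diff_left: "x \<in> carr \<Longrightarrow> y \<in> carr \<Longrightarrow> z \<in> carr \<Longrightarrow> ip (x - y) z = ip x z - ip y z"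
  using inner_add_left[of "x - y" y z] by simp
lemma ip_diff_right: "x \<in> carr \<Longrightarrow> y \<in> carr \<Longrightarrow> z \<in> carr \<Longrightarrow> ip z (x - y) = ip z x - ip z y"
  using ip_add_right[of "x - y" y z] by simp
lemma ip_sum_left:
  assumes "\<And>i. i \<in> F \<Longrightarrow> f i \<in> carr" "y \<in> carr"
  shows "ip (sum f F) y = (\<Sum>i\<in>F. ip (f i) y)"
  using assms by (induction F rule: infinite_finite_induct) (auto simp: inner_add_left)
lemma ip_sum_right:
  assumes "\<And>i. i \<in> F \<Longrightarrow> f i \<in> carr" "y \<in> carr"
  shows "ip y (sum f F) = (\<Sum>i\<in>F. ip y (f i))"
  using inner_commute[of "sum f F" y] assms inner_commute[OF _ assms(2)]
  by (simp add: ip_sum_left)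

lemma ip_self: "x \<in> carr \<Longrightarrow> ip x x = complex_of_real (Re (ip x x))"
  using inner_commute[of x x] by (simp add: complex_eq_iff)
lemma Re_ip_nonneg: "x \<in> carr \<Longrightarrow> 0 \<le> Re (ip x x)"
  using inner_pos[of x] by (cases "x = 0") auto
lemma nm_nonneg [simp]: "x \<in> carr \<Longrightarrow> 0 \<le> nm x"
  by (simp add: hnorm_def Re_ip_nonneg)
lemma nm_sq: "x \<in> carr \<Longrightarrow> (nm x)\<^sup>2 = Re (ip x x)"
  by (simp add: hnorm_def Re_ip_nonneg)
lemma ip_eq_nm: "x \<in> carr \<Longrightarrow> ip x x = complex_of_real ((nm x)\<^sup>2)"
  using ip_self nm_sq by simp
lemma nm_eq_0: "x \<in> carr \<Longrightarrow> nm x = 0 \<longleftrightarrow> x = 0"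
  using inner_pos[of x] by (cases "x = 0") (auto simp: hnorm_def)
lemma ip_self_eq_0: "x \<in> carr \<Longrightarrow> ip x x = 0 \<longleftrightarrow> x = 0"
  using inner_pos[of x] by (cases "x = 0") auto
lemma nm_scale: "x \<in> carr \<Longrightarrow> nm (c *\<^sub>H x) = cmod c * nm x"
proof -
  assume x: "x \<in> carr"
  have "ip (c *\<^sub>H x) (c *\<^sub>H x) = complex_of_real ((cmod c)\<^sup>2 * (nm x)\<^sup>2)"
    using x complex_norm_square[of c] by (simp add: inner_scale_left ip_scale_right ip_eq_nm[OF x])
  hence "(nm (c *\<^sub>H x))\<^sup>2 = (cmod c * nm x)\<^sup>2"
    using x nm_sq[of "c *\<^sub>H x"] by (simp add: power_mult_distrib)
  thus ?thesis using x by (simp add: power2_eq_iff_nonneg)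
qed

definition orthonormal :: "'i set \<Rightarrow> ('i \<Rightarrow> 'v) \<Rightarrow> bool" where
  "orthonormal K e \<longleftrightarrow> (\<forall>i\<in>K. e i \<in> carr) \<and> (\<forall>i\<in>K. \<forall>j\<in>K. ip (e i) (e j) = (if i = j then 1 else 0))"

lemma orthonormal_mem: "orthonormal K e \<Longrightarrow> i \<in> K \<Longrightarrow> e i \<in> carr"
  by (simp add: orthonormal_def)
lemma orthonormal_ip: "orthonormal K e \<Longrightarrow> i \<in> K \<Longrightarrow> j \<in> K \<Longrightarrow> ip (e i) (e j) = (if i = j then 1 else 0)"
  by (simp add: orthonormal_def)
lemma orthonormal_subset: "orthonormal K e \<Longrightarrow> L \<subseteq> K \<Longrightarrow> orthonormal L e"
  unfolding orthonormal_def by blast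

lemma orthonormal_comb_ip:
  assumes "orthonormal K e" "finite F" "F \<subseteq> K" "k \<in> K"
  shows "ip (\<Sum>i\<in>F. f i *\<^sub>H e i) (e k) = (if k \<in> F then f k else 0)"
proof -
  note m = orthonormal_mem[OF assms(1)]
  have "ip (\<Sum>i\<in>F. f i *\<^sub>H e i) (e k) = (\<Sum>i\<in>F. ip (f i *\<^sub>H e i) (e k))"
    using assms m by (intro ip_sum_left scale_mem) blast+
  also have "\<dots> = (\<Sum>i\<in>F. if i = k then f i else 0)"
    using assms m by (intro sum.cong) (auto simp: inner_scale_left subset_iff orthonormal_ip)
  finally have "ip (\<Sum>i\<in>F. f i *\<^sub>H e i) (e k) = (\<Sum>i\<in>F. if i = k then f i else 0)" .
  thus ?thesis using assms(2) by (simp add: sum.delta)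
qed

lemma orthonormal_comb_inner:
  assumes "orthonormal K e" "finite F" "F \<subseteq> K" "finite G" "G \<subseteq> K"
  shows "ip (\<Sum>i\<in>F. f i *\<^sub>H e i) (\<Sum>i\<in>G. g i *\<^sub>H e i) = (\<Sum>i\<in>F \<inter> G. f i * cnj (g i))"
proof -
  note m = orthonormal_mem[OF assms(1)]
  have "ip (\<Sum>i\<in>F. f i *\<^sub>H e i) (\<Sum>i\<in>G. g i *\<^sub>H e i)
      = (\<Sum>k\<in>G. cnj (g k) * (if k \<in> F then f k else 0))"
    using assms m
    by (subst ip_sum_right) (auto simp: ip_scale_right subset_iff orthonormal_comb_ip intro!: sum.cong)
  also have "\<dots> = (\<Sum>k\<in>G. if k \<in> F then f k * cnj (g k) else 0)"
    by (intro sum.cong) (auto simp: mult.commute)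
  also have "\<dots> = (\<Sum>i\<in>F \<inter> G. f i * cnj (g i))"
    using assms by (simp add: sum.inter_restrict[of G, symmetric] Int_commute)
  finally show ?thesis .
qed

lemma orthonormal_comb_nm:
  assumes "orthonormal K e" "finite F" "F \<subseteq> K"
  shows "(nm (\<Sum>i\<in>F. f i *\<^sub>H e i))\<^sup>2 = (\<Sum>i\<in>F. (cmod (f i))\<^sup>2)"
proof -
  have m: "(\<Sum>i\<in>F. f i *\<^sub>H e i) \<in> carr"
    using orthonormal_mem[OF assms(1)] assms(3) by (intro sum_mem scale_mem) blast
  have "ip (\<Sum>i\<in>F. f i *\<^sub>H e i) (\<Sum>i\<in>F. f i *\<^sub>H e i) = complex_of_real (\<Sum>i\<in>F. (cmod (f i))\<^sup>2)"
    using orthonormal_comb_inner[OF assms(1,2,3,2,3), of f f]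
    by (simp only: complex_norm_square of_real_sum Int_absorb)
  thus ?thesis using nm_sq[OF m] by simp
qed

lemma bessel_finite:
  assumes "orthonormal K e" "finite F" "F \<subseteq> K" "x \<in> carr"
  shows "(\<Sum>i\<in>F. (cmod (ip x (e i)))\<^sup>2) \<le> (nm x)\<^sup>2"
proof -
  define p where "p = (\<Sum>i\<in>F. ip x (e i) *\<^sub>H e i)"
  have m: "\<And>i. i \<in> F \<Longrightarrow> e i \<in> carr" using orthonormal_mem[OF assms(1)] assms(3) by blast
  have p: "p \<in> carr" unfolding p_def using m by auto
  have xp: "ip x p = complex_of_real (\<Sum>i\<in>F. (cmod (ip x (e i)))\<^sup>2)"
    unfolding p_def using m assms(4)
    by (subst ip_sum_right) (auto simp: ip_scale_right complex_norm_square mult.commute simp del: of_real_power)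
  have pp: "ip p p = complex_of_real (\<Sum>i\<in>F. (cmod (ip x (e i)))\<^sup>2)"
    using orthonormal_comb_nm[OF assms(1-3), of "\<lambda>i. ip x (e i)"] ip_eq_nm[OF p]
    unfolding p_def by simp
  have "ip (x - p) (x - p) = ip x x - ip x p - ip p x + ip p p"
    using assms(4) p by (simp add: ip_diff_left ip_diff_right)
  hence "Re (ip (x - p) (x - p)) = Re (ip x x) - (\<Sum>i\<in>F. (cmod (ip x (e i)))\<^sup>2)"
    using xp pp inner_commute[OF assms(4) p] by simp
  thus ?thesis using Re_ip_nonneg[of "x - p"] nm_sq[OF assms(4)] p assms(4) by auto
qed

lemma bessel_summable:
  assumes "orthonormal K e" "x \<in> carr"
  shows "(\<lambda>i. (cmod (ip x (e i)))\<^sup>2) summable_on K"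
  by (rule nonneg_bdd_above_summable_on) (auto intro!: bdd_aboveI2 bessel_finite[OF assms(1) _ _ assms(2)])

lemma bessel:
  assumes "orthonormal K e" "x \<in> carr"
  shows "(\<Sum>\<^sub>\<infinity>i\<in>K. (cmod (ip x (e i)))\<^sup>2) \<le> (nm x)\<^sup>2"
  by (rule infsum_le_finite_sums[OF bessel_summable[OF assms]]) (auto intro: bessel_finite[OF assms(1) _ _ assms(2)])

lemma normalize_nm: "x \<in> carr \<Longrightarrow> x \<noteq> 0 \<Longrightarrow> nm (complex_of_real (1 / nm x) *\<^sub>H x) = 1"
  using nm_eq_0[of x] nm_nonneg[of x] by (simp add: nm_scale norm_divide)

text \<open>Bessel's inequality for the one-element family consisting of \<open>y\<close>
  normalised.\<close>

lemma cauchy_schwarz: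
  assumes "x \<in> carr" "y \<in> carr"
  shows "cmod (ip x y) \<le> nm x * nm y"
proof (cases "y = 0")
  case True thus ?thesis using assms by simp
next
  case False
  define u where "u = complex_of_real (1 / nm y) *\<^sub>H y"
  have u: "u \<in> carr" using assms by (simp add: u_def)
  have "ip u u = 1" using ip_eq_nm[OF u] normalize_nm[OF assms(2) False] by (simp add: u_def)
  hence "orthonormal {()} (\<lambda>_. u)" using u by (simp add: orthonormal_def)
  from bessel_finite[OF this, of "{()}" x] have "(cmod (ip x u))\<^sup>2 \<le> (nm x)\<^sup>2" using assms by simp
  hence "cmod (ip x u) \<le> nm x" using assms by (simp add: power2_le_iff_abs_le)
  moreover have "0 < nm y" using False assms nm_eq_0 nm_nonneg by (metis less_eq_real_def)
  ultimately show ?thesis using assms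
    by (simp add: u_def ip_scale_right norm_mult norm_divide field_simps)
qed

lemma nm_triangle:
  assumes "x \<in> carr" "y \<in> carr"
  shows "nm (x + y) \<le> nm x + nm y"
proof (rule power2_le_imp_le)
  have "(nm (x + y))\<^sup>2 = (nm x)\<^sup>2 + (nm y)\<^sup>2 + 2 * Re (ip x y)"
    using assms inner_commute[of x y] by (simp add: nm_sq inner_add_left ip_add_right)
  also have "Re (ip x y) \<le> nm x * nm y"
    using complex_Re_le_cmod cauchy_schwarz[OF assms] by (rule order_trans)
  finally show "(nm (x + y))\<^sup>2 \<le> (nm x + nm y)\<^sup>2" by (simp add: power2_sum)
  show "0 \<le> nm x + nm y" using assms by simp
qed

lemma nm_minus: "x \<in> carr \<Longrightarrow> y \<in> carr \<Longrightarrow> nm (x - y) = nm (y - x)"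
  using nm_scale[of "x - y" "-1"] by simp

lemma ip_ext:
  assumes "x \<in> carr" "y \<in> carr" "\<And>z. z \<in> carr \<Longrightarrow> ip x z = ip y z"
  shows "x = y"
  using ip_self_eq_0[of "x - y"] assms by (simp add: ip_diff_left)

text \<open>Squared distances of partial sums are differences of partial sums of a convergent real
  series, so completeness provides a limit. It is recorded through its inner products, as unordered
  sums; this is the form in which Parseval's identity and the surjectivity of coordinate maps use
  it.\<close>

theorem riesz_fischer:
  fixes e :: "'i::countable \<Rightarrow> 'v"
  assumes on: "orthonormal K e" and f: "(\<lambda>k. (cmod (f k))\<^sup>2) summable_on K"
  obtains z where "z \<in> carr"
    "\<And>y. y \<in> carr \<Longrightarrow> ((\<lambda>k. f k * ip (e k) y) has_sum ip z y) K"
    "\<And>k. k \<in> K \<Longrightarrow> ip z (e k) = f k"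
proof -
  note m = orthonormal_mem[OF on]
  \<comment> \<open>Completeness speaks of sequences, whereas \<open>has_sum\<close> is a limit over
    finite subsets; the finite sets \<open>A n\<close> exhaust \<open>K\<close> and connect the
    two.\<close>
  define A where "A n = {k\<in>K. to_nat k < n}" for n
  have finA: "finite (A n)" for n
  proof -
    have "to_nat ` A n \<subseteq> {..<n}" by (auto simp: A_def)
    thus ?thesis using finite_imageD[OF finite_subset] inj_on_subset[OF inj_to_nat] by blast
  qed
  have AK: "A n \<subseteq> K" for n by (auto simp: A_def)
  have Amono: "m \<le> n \<Longrightarrow> A m \<subseteq> A n" for m n by (auto simp: A_def)
  have Alim: "filterlim A (finite_subsets_at_top K) sequentially"
    unfolding filterlim_finite_subsets_at_top
  proof (intro allI impI)
    fix X assume X: "finite X \<and> X \<subseteq> K"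
    show "\<forall>\<^sub>F n in sequentially. finite (A n) \<and> X \<subseteq> A n \<and> A n \<subseteq> K"
    proof (rule eventually_sequentiallyI[of "Suc (Max (to_nat ` X))"])
      fix n assume n: "Suc (Max (to_nat ` X)) \<le> n"
      have "x \<in> A n" if "x \<in> X" for x
      proof -
        have "to_nat x \<le> Max (to_nat ` X)" using X that by (intro Max_ge) auto
        hence "to_nat x < n" using n by linarith
        thus ?thesis using X that by (auto simp: A_def)
      qed
      thus "finite (A n) \<and> X \<subseteq> A n \<and> A n \<subseteq> K" using finA AK by blast
    qed
  qed
  define s where "s n = (\<Sum>k\<in>A n. f k *\<^sub>H e k)" for n
  have s: "s n \<in> carr" for n unfolding s_def using m AK by (intro sum_mem scale_mem) blast
  define S where "S n = (\<Sum>k\<in>A n. (cmod (f k))\<^sup>2)" for n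
  have "S \<longlonglongrightarrow> (\<Sum>\<^sub>\<infinity>k\<in>K. (cmod (f k))\<^sup>2)"
    unfolding S_def using has_sum_infsum[OF f, unfolded has_sum_def] Alim by (rule filterlim_compose)
  hence cS: "Cauchy S" using LIMSEQ_imp_Cauchy by blast
  have diff: "(nm (s n - s k))\<^sup>2 = S n - S k" if "k \<le> n" for k n
  proof -
    have "s n - s k = (\<Sum>k\<in>A n - A k. f k *\<^sub>H e k)"
      unfolding s_def using Amono[OF that] finA by (simp add: sum_diff)
    hence "(nm (s n - s k))\<^sup>2 = (\<Sum>k\<in>A n - A k. (cmod (f k))\<^sup>2)"
      using orthonormal_comb_nm[OF on, of "A n - A k" f] finA AK by auto
    thus ?thesis unfolding S_def using Amono[OF that] finA by (simp add: sum_diff)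
  qed
  have "\<forall>e>0. \<exists>N. \<forall>m\<ge>N. \<forall>n\<ge>N. nm (s m - s n) < e"
  proof (intro allI impI)
    fix \<epsilon> :: real assume e: "0 < \<epsilon>"
    then obtain N where N: "\<And>m n. m \<ge> N \<Longrightarrow> n \<ge> N \<Longrightarrow> \<bar>S m - S n\<bar> < \<epsilon>\<^sup>2"
      using cS unfolding Cauchy_def dist_real_def by (meson zero_less_power)
    have "nm (s m - s n) < \<epsilon>" if "N \<le> m" "N \<le> n" for m n
    proof -
      have "(nm (s m - s n))\<^sup>2 = \<bar>S m - S n\<bar>"
        using diff[of m n] diff[of n m] nm_minus[OF s s, of m n]
        by (metis abs_minus_commute abs_of_nonneg linorder_le_cases zero_le_power2)
      thus ?thesis using N[OF that] e by (intro power2_less_imp_less[of _ \<epsilon>]) auto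
    qed
    thus "\<exists>N. \<forall>m\<ge>N. \<forall>n\<ge>N. nm (s m - s n) < \<epsilon>" by blast
  qed
  from complete[OF s this] obtain z where z: "z \<in> carr" and lim: "(\<lambda>n. nm (s n - z)) \<longlonglongrightarrow> 0" by blast
  have iplim: "(\<lambda>n. ip (s n) y) \<longlonglongrightarrow> ip z y" if y: "y \<in> carr" for y
  proof -
    have "(\<lambda>n. nm (s n - z) * nm y) \<longlonglongrightarrow> 0" using lim by (rule tendsto_mult_left_zero)
    moreover have "norm (ip (s n) y - ip z y) \<le> nm (s n - z) * nm y" for n
      using cauchy_schwarz[of "s n - z" y] s z y by (simp add: ip_diff_left)
    ultimately have "(\<lambda>n. ip (s n) y - ip z y) \<longlonglongrightarrow> 0"
      by (metis (no_types, lifting) Lim_null_comparison always_eventually)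
    thus ?thesis by (simp add: LIM_zero_iff)
  qed
  have hs: "((\<lambda>k. f k * ip (e k) y) has_sum ip z y) K" if y: "y \<in> carr" for y
  proof -
    have "(\<lambda>k. (cmod (ip (e k) y))\<^sup>2) summable_on K"
      using bessel_summable[OF on y] inner_commute[OF y m]
      by (subst summable_on_cong[of K _ "\<lambda>k. (cmod (ip y (e k)))\<^sup>2"]) auto
    \<comment> \<open>Unordered summability is secured first; the sum can then be computed along the
      single sequence \<open>A n\<close>.\<close>
    hence "(\<lambda>k. f k * ip (e k) y) summable_on K" by (intro square_summable_mult f)
    then obtain t where t: "((\<lambda>k. f k * ip (e k) y) has_sum t) K" by (auto simp: summable_on_def)
    have "(\<lambda>n. \<Sum>k\<in>A n. f k * ip (e k) y) \<longlonglongrightarrow> t"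
      using t[unfolded has_sum_def] Alim by (rule filterlim_compose)
    moreover have "(\<Sum>k\<in>A n. f k * ip (e k) y) = ip (s n) y" for n
      unfolding s_def using m AK y by (subst ip_sum_left) (auto simp: inner_scale_left subset_iff)
    ultimately have "t = ip z y" using iplim[OF y] by (metis (no_types, lifting) LIMSEQ_unique ext)
    thus ?thesis using t by simp
  qed
  moreover have "ip z (e k) = f k" if k: "k \<in> K" for k
  proof -
    have "((\<lambda>j. f j * ip (e j) (e k)) has_sum f k) K"
      using k orthonormal_ip[OF on _ k]
      by (intro has_sum_finite_neutralI[of "{k}"]) auto
    thus ?thesis using hs[OF m[OF k]] has_sum_unique by blast
  qed
  ultimately show ?thesis using that z by blast
qed

text \<open>The Riesz-Fischer vector built from the coefficients of \<open>x\<close> differs from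
  \<open>x\<close> by a vector orthogonal to the whole family, so totality identifies the
  two.\<close>

theorem parseval:
  fixes e :: "'i::countable \<Rightarrow> 'v"
  assumes on: "orthonormal K e" and total: "\<And>y. y \<in> carr \<Longrightarrow> (\<And>k. k \<in> K \<Longrightarrow> ip y (e k) = 0) \<Longrightarrow> y = 0"
    and x: "x \<in> carr" and y: "y \<in> carr"
  shows "((\<lambda>k. ip x (e k) * cnj (ip y (e k))) has_sum ip x y) K"
proof -
  note m = orthonormal_mem[OF on]
  obtain z where z: "z \<in> carr"
    "\<And>y. y \<in> carr \<Longrightarrow> ((\<lambda>k. ip x (e k) * ip (e k) y) has_sum ip z y) K"
    "\<And>k. k \<in> K \<Longrightarrow> ip z (e k) = ip x (e k)"
    using riesz_fischer[OF on bessel_summable[OF on x]] by blast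
  have "x - z = 0" using total[of "x - z"] x z m by (simp add: ip_diff_left)
  hence "((\<lambda>k. ip x (e k) * ip (e k) y) has_sum ip x y) K" using z(2)[OF y] by simp
  thus ?thesis using inner_commute[OF y m] by (subst has_sum_cong[where g="\<lambda>k. ip x (e k) * ip (e k) y"]) auto
qed

end

section \<open>The CMV basis of a cyclic subspace\<close>

text \<open>Closes the gaps left by discarded Gram-Schmidt vectors; monotonicity is what preserves
  the band.\<close>

lemma enumerate_nat_set:
  fixes S :: "nat set"
  obtains D :: "nat set" and r where "D = UNIV \<or> (\<exists>N. D = {..<N})" "bij_betw r D S" "strict_mono_on D r"
proof (cases "finite S")
  case True
  thus ?thesis using that[of "{..<card S}" "enumerate S"] finite_bij_enumerate
      finite_enumerate_mono[OF _ True] by (auto simp: strict_mono_on_def)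
next
  case False
  thus ?thesis using that[of UNIV "enumerate S"] bij_enumerate enumerate_mono
    by (auto simp: strict_mono_on_def)
qed

section \<open>Gram-Schmidt for possibly dependent sequences\<close>

context complex_hilbert_space
begin

text \<open>Since \<open>1 / 0 = 0\<close>, a vector that depends linearly on its predecessors is sent to \<open>0\<close>.\<close>

function gram_schmidt :: "(nat \<Rightarrow> 'v) \<Rightarrow> nat \<Rightarrow> 'v" where
  "gram_schmidt w n =
     (let g = w n - (\<Sum>k<n. ip (w n) (gram_schmidt w k) *\<^sub>H gram_schmidt w k)
      in complex_of_real (1 / nm g) *\<^sub>H g)"
  by auto
termination by (relation "Wellfounded.measure snd") auto

declare gram_schmidt.simps [simp del]

lemma span_orthogonal:
  assumes "B \<subseteq> carr" "y \<in> carr" "\<And>b. b \<in> B \<Longrightarrow> ip b y = 0" "x \<in> span B"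
  shows "ip x y = 0"
proof -
  have "x \<in> carr \<and> ip x y = 0"
    using assms(4)
    by (induction rule: span_induct_alt) (use assms(1-3) in \<open>auto simp: inner_add_left inner_scale_left subset_iff\<close>)
  thus ?thesis ..
qed

lemma linear_span_image:
  assumes "linear_map_on H H T" "B \<subseteq> carr" "T ` B \<subseteq> span C" "x \<in> span B"
  shows "T x \<in> span C"
proof -
  have T: "\<And>x y. x \<in> carr \<Longrightarrow> y \<in> carr \<Longrightarrow> T (x + y) = T x + T y"
    "\<And>c x. x \<in> carr \<Longrightarrow> T (c *\<^sub>H x) = c *\<^sub>H T x"
    using assms(1) by (auto simp: linear_map_on_def)
  have T0: "T 0 = 0" using T(2)[of 0 0] by simp
  have "x \<in> carr \<and> T x \<in> span C"
    using assms(4)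
  proof (induction rule: span_induct_alt)
    case base thus ?case by (simp add: T0 span_zero)
  next
    case (step c x y)
    hence "x \<in> carr" "T x \<in> span C" using assms(2,3) by auto
    thus ?case using step by (simp add: T span_add span_scale)
  qed
  thus ?thesis ..
qed

context
  fixes w :: "nat \<Rightarrow> 'v"
  assumes w: "\<And>n. w n \<in> carr"
begin

private abbreviation e where "e \<equiv> gram_schmidt w"
private definition "g n = w n - (\<Sum>k<n. ip (w n) (e k) *\<^sub>H e k)"

private lemma e_g: "e n = complex_of_real (1 / nm (g n)) *\<^sub>H g n"
  by (subst gram_schmidt.simps) (simp add: g_def Let_def)

lemma gram_schmidt_mem: "gram_schmidt w n \<in> carr"
proof (induction n rule: less_induct)
  case (less n)
  hence "g n \<in> carr" unfolding g_def using w by (intro diff_mem sum_mem scale_mem) auto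
  thus ?case unfolding e_g by (rule scale_mem)
qed

private lemma g_mem: "g n \<in> carr"
  unfolding g_def using w gram_schmidt_mem by (intro diff_mem sum_mem scale_mem) auto

private lemma g_e: "g n = complex_of_real (nm (g n)) *\<^sub>H e n"
  using nm_eq_0[OF g_mem, of n] unfolding e_g by (cases "g n = 0") auto

lemma gram_schmidt_self: "gram_schmidt w n \<noteq> 0 \<Longrightarrow> ip (gram_schmidt w n) (gram_schmidt w n) = 1"
  using ip_eq_nm[OF gram_schmidt_mem, of n] normalize_nm[OF g_mem, of n]
  by (cases "g n = 0") (auto simp: e_g)

private lemma orth_less: "j < n \<Longrightarrow> ip (e n) (e j) = 0"
proof (induction n arbitrary: j rule: less_induct)
  case (less n)
  note m = gram_schmidt_mem
  have sym: "ip (e k) (e j) = 0" if "k < n" "k \<noteq> j" for k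
    using that less.IH[of k j] less.IH[of j k] less.prems inner_commute[OF m m, of j k]
    by (cases "j < k") auto
  have "(\<Sum>k<n. ip (w n) (e k) * ip (e k) (e j)) = (\<Sum>k<n. if k = j then ip (w n) (e k) * ip (e k) (e j) else 0)"
    using sym by (intro sum.cong) auto
  also have "\<dots> = ip (w n) (e j) * ip (e j) (e j)" using less.prems by simp
  \<comment> \<open>The factor \<open>ip (e j) (e j)\<close> is 1 unless \<open>e j\<close> is zero,
    and then both sides vanish.\<close>
  also have "\<dots> = ip (w n) (e j)"
    using gram_schmidt_self[of j] w by (cases "e j = 0") auto
  finally have "ip (g n) (e j) = 0"
    unfolding g_def using w m by (subst ip_diff_left) (auto simp: ip_sum_left inner_scale_left)
  thus ?case unfolding e_g[of n] using inner_scale_left[OF g_mem m] by simp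
qed

lemma gram_schmidt_orthogonal: "i \<noteq> j \<Longrightarrow> ip (gram_schmidt w i) (gram_schmidt w j) = 0"
  using orth_less[of i j] orth_less[of j i] inner_commute[OF gram_schmidt_mem gram_schmidt_mem, of i j]
  by (cases "i < j") auto

lemma span_gram_schmidt: "span (gram_schmidt w ` {..n}) = span (w ` {..n})"
proof -
  have 1: "e k \<in> span (w ` {..n})" if "k \<le> n" for k n
    using that
  proof (induction k rule: less_induct)
    case (less k)
    have "g k \<in> span (w ` {..n})"
      unfolding g_def using less by (intro span_diff span_sum span_scale) (auto intro: span_base)
    thus ?case unfolding e_g[of k] by (rule span_scale)
  qed
  have 2: "w k \<in> span (e ` {..n})" if "k \<le> n" for k
  proof -
    \<comment> \<open>For a dependent \<open>w k\<close> the first summand is zero, so the expansion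
      covers this case too.\<close>
    have "w k = complex_of_real (nm (g k)) *\<^sub>H e k + (\<Sum>j<k. ip (w k) (e j) *\<^sub>H e j)"
      using g_e[of k] by (simp add: g_def)
    also have "\<dots> \<in> span (e ` {..n})"
      using that by (intro span_add span_sum span_scale) (auto intro: span_base)
    finally show ?thesis .
  qed
  show ?thesis using 1 2 by (intro antisym span_minimal subspace_span) auto
qed

end

end

section \<open>Unitary operators and the interleaved orbit\<close>

locale hilbert_unitary = complex_hilbert_space H for H :: "'v::ab_group_add hilbert" +
  fixes U :: "'v \<Rightarrow> 'v"
  assumes unitary: "unitary_operator H U"
begin

lemma U_linear: "linear_map_on H H U"
  using unitary by (simp add: unitary_map_def)
lemma U_mem [simp]: "x \<in> carr \<Longrightarrow> U x \<in> carr"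
  using U_linear by (simp add: linear_map_on_def)
lemma U_ip: "x \<in> carr \<Longrightarrow> y \<in> carr \<Longrightarrow> ip (U x) (U y) = ip x y"
  using unitary by (simp add: unitary_map_def)
lemma U_image: "U ` carr = carr"
  using unitary by (simp add: unitary_map_def)

definition Uinv where "Uinv = inv_into carr U"

lemma Uinv_mem [simp]: "x \<in> carr \<Longrightarrow> Uinv x \<in> carr"
  unfolding Uinv_def using U_image by (metis inv_into_into)
lemma U_Uinv [simp]: "x \<in> carr \<Longrightarrow> U (Uinv x) = x"
  unfolding Uinv_def using U_image by (metis f_inv_into_f)
lemma U_adjoint: "x \<in> carr \<Longrightarrow> y \<in> carr \<Longrightarrow> ip (U x) y = ip x (Uinv y)"
  using U_ip[of x "Uinv y"] by simp
lemma Uinv_adjoint: "x \<in> carr \<Longrightarrow> y \<in> carr \<Longrightarrow> ip (Uinv x) y = ip x (U y)"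
  using U_ip[of "Uinv x" y] by simp
text \<open>Injectivity comes from preservation of inner products: both sides have the same inner
  product with every vector.\<close>

lemma Uinv_U [simp]: "x \<in> carr \<Longrightarrow> Uinv (U x) = x"
  by (rule ip_ext) (simp_all add: Uinv_adjoint U_ip)
lemma U_add: "x \<in> carr \<Longrightarrow> y \<in> carr \<Longrightarrow> U (x + y) = U x + U y"
  using U_linear by (simp add: linear_map_on_def)
lemma U_scale: "x \<in> carr \<Longrightarrow> U (c *\<^sub>H x) = c *\<^sub>H U x"
  using U_linear by (simp add: linear_map_on_def)
lemma Uinv_linear: "linear_map_on H H Uinv"
  unfolding linear_map_on_def
proof (intro conjI ballI allI)
  fix x y assume "x \<in> carr" "y \<in> carr"
  thus "Uinv (x + y) = Uinv x + Uinv y" using Uinv_U[of "Uinv x + Uinv y"] by (simp add: U_add)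
next
  fix c x assume "x \<in> carr"
  thus "Uinv (c *\<^sub>H x) = c *\<^sub>H Uinv x" using Uinv_U[of "c *\<^sub>H Uinv x"] by (simp add: U_scale)
qed simp
lemma U_nm: "x \<in> carr \<Longrightarrow> nm (U x) = nm x"
  by (simp add: hnorm_def U_ip)

definition cmv_orbit :: "'v \<Rightarrow> nat \<Rightarrow> 'v" where
  "cmv_orbit v n = (if even n then (Uinv ^^ (n div 2)) v else (U ^^ (Suc (n div 2))) v)"

lemma U_pow_mem: "v \<in> carr \<Longrightarrow> (U ^^ n) v \<in> carr"
  by (induction n) auto
lemma Uinv_pow_mem: "v \<in> carr \<Longrightarrow> (Uinv ^^ n) v \<in> carr"
  by (induction n) auto
lemma cmv_orbit_mem: "v \<in> carr \<Longrightarrow> cmv_orbit v n \<in> carr"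
  unfolding cmv_orbit_def using U_pow_mem[of v "Suc (n div 2)"] Uinv_pow_mem[of v] by (auto simp del: funpow.simps)
lemma cmv_orbit_0: "cmv_orbit v 0 = v" by (simp add: cmv_orbit_def)

text \<open>Along odd indices \<open>U\<close> climbs two places, along even ones it descends two,
  and the branches are joined by the step from 0 to 1.\<close>

lemma U_cmv_orbit:
  assumes "v \<in> carr"
  shows "U (cmv_orbit v n) \<in> cmv_orbit v ` {..n + 2}"
proof (cases "even n")
  case False
  hence "U (cmv_orbit v n) = cmv_orbit v (n + 2)" by (simp add: cmv_orbit_def)
  thus ?thesis by blast
next
  case True
  then obtain k where k: "n = 2 * k" by blast
  show ?thesis
  proof (cases k)
    case 0
    hence "U (cmv_orbit v n) = cmv_orbit v 1" using k by (simp add: cmv_orbit_def)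
    thus ?thesis using k by auto
  next
    case (Suc m)
    hence "U (cmv_orbit v n) = cmv_orbit v (2 * m)"
      using k Uinv_pow_mem[OF assms] by (simp add: cmv_orbit_def)
    thus ?thesis using k Suc by auto
  qed
qed

text \<open>The mirror image: the inverse climbs along even indices and descends along odd ones,
  with 1 going to 0.\<close>

lemma Uinv_cmv_orbit:
  assumes "v \<in> carr"
  shows "Uinv (cmv_orbit v n) \<in> cmv_orbit v ` {..n + 2}"
proof (cases "even n")
  case True
  hence "Uinv (cmv_orbit v n) = cmv_orbit v (n + 2)" by (simp add: cmv_orbit_def)
  thus ?thesis by blast
next
  case False
  then obtain k where k: "n = 2 * k + 1" using oddE by blast
  show ?thesis
  proof (cases k)
    case 0
    hence "Uinv (cmv_orbit v n) = cmv_orbit v 0" using k assms by (simp add: cmv_orbit_def)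
    thus ?thesis by auto
  next
    case (Suc m)
    hence "Uinv (cmv_orbit v n) = cmv_orbit v (2 * m + 1)"
      using k U_pow_mem[OF assms] by (simp add: cmv_orbit_def)
    thus ?thesis using k Suc by (auto simp del: One_nat_def)
  qed
qed

text \<open>Each conclusion has its use in the assembly: membership in the span of the orbit makes
  different blocks orthogonal, spanning the orbit gives totality, invariance under
  \<open>Uinv\<close> makes the block operator well defined, and the last clause is the
  band.\<close>

lemma cmv_basis:
  assumes v: "v \<in> carr" "v \<noteq> 0"
  obtains I :: "nat set" and e where "matrix_index_set I" "orthonormal I e"
    "\<And>i. i \<in> I \<Longrightarrow> e i \<in> span (range (cmv_orbit v))"
    "\<And>n. cmv_orbit v n \<in> span (e ` I)"
    "\<And>i. i \<in> I \<Longrightarrow> Uinv (e i) \<in> span (e ` I)"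
    "\<And>i j. i \<in> I \<Longrightarrow> j \<in> I \<Longrightarrow> i > j + 2 \<or> j > i + 2 \<Longrightarrow> ip (U (e j)) (e i) = 0"
proof -
  define w where "w = cmv_orbit v"
  define b where "b = gram_schmidt w"
  have w: "\<And>n. w n \<in> carr" using cmv_orbit_mem v w_def by simp
  have b: "\<And>n. b n \<in> carr" using gram_schmidt_mem[OF w] b_def by simp
  have sp: "span (b ` {..n}) = span (w ` {..n})" for n
    using span_gram_schmidt[OF w] b_def by simp
  have b_w: "b n \<in> span (w ` {..n})" for n
    unfolding sp[symmetric] by (auto intro: span_base)
  have w_b: "w n \<in> span (b ` {..n})" for n
    unfolding sp by (auto intro: span_base)
  \<comment> \<open>Stated for a general \<open>T\<close> because the two sides of the band need it
    for \<open>U\<close> and for \<open>Uinv\<close>.\<close>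
  have up: "T (b n) \<in> span (b ` {..n + 2})"
    if T: "linear_map_on H H T" "\<And>n. T (w n) \<in> w ` {..n + 2}" for T n
  proof -
    have "T ` (w ` {..n}) \<subseteq> span (w ` {..n + 2})"
      using T(2) by (fastforce intro: span_base)
    thus ?thesis unfolding sp using w by (intro linear_span_image[OF T(1) _ _ b_w]) auto
  qed
  have Ub: "U (b n) \<in> span (b ` {..n + 2})" for n
    using U_cmv_orbit[OF v(1)] by (intro up U_linear) (simp add: w_def)
  have Uib: "Uinv (b n) \<in> span (b ` {..n + 2})" for n
    using Uinv_cmv_orbit[OF v(1)] by (intro up Uinv_linear) (simp add: w_def)
  have orth: "ip (b i) (b j) = 0" if "i \<noteq> j" for i j
    using gram_schmidt_orthogonal[OF w that] b_def by simp
  have far: "ip x (b i) = 0" if "x \<in> span (b ` {..j + 2})" "i > j + 2" for x i j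
    using that b by (intro span_orthogonal[OF _ _ _ that(1)]) (auto intro: orth)
  \<comment> \<open>The nonzero Gram-Schmidt vectors are numbered by an initial segment
    \<open>D\<close>, which is finite exactly when the orbit spans a finite-dimensional
    space.\<close>
  obtain D :: "nat set" and r where D: "D = UNIV \<or> (\<exists>N. D = {..<N})" and r: "bij_betw r D {n. b n \<noteq> 0}" "strict_mono_on D r"
    by (rule enumerate_nat_set[of "{n. b n \<noteq> 0}"])
  \<comment> \<open>Matrix indices begin at 1, the enumeration at 0.\<close>
  define I where "I = Suc ` D"
  define e where "e i = b (r (i - 1))" for i
  have e_Suc: "e (Suc d) = b (r d)" for d by (simp add: e_def)
  \<comment> \<open>Makes \<open>I\<close> nonempty, as a matrix must have positive size.\<close>
  have "b 0 \<noteq> 0"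
  proof
    assume "b 0 = 0"
    hence "v \<in> span {0}" using w_b[of 0] by (simp add: w_def cmv_orbit_0)
    thus False using v(2) by simp
  qed
  then obtain d0 where d0: "d0 \<in> D" using r(1) by (auto simp: bij_betw_def)
  have 1: "matrix_index_set I"
    using D
  proof
    assume "D = UNIV"
    hence "I = {1..}" unfolding I_def by (auto simp: image_iff) (metis Suc_le_D)
    thus ?thesis by (simp add: matrix_index_set_def)
  next
    assume "\<exists>N. D = {..<N}"
    then obtain N where N: "D = {..<N}" ..
    hence "I = {1..N}" unfolding I_def using image_Suc_lessThan by blast
    moreover have "N \<ge> 1" using d0 N by auto
    ultimately show ?thesis by (auto simp: matrix_index_set_def)
  qed
  have nz: "b (r d) \<noteq> 0" if "d \<in> D" for d using r(1) that by (auto simp: bij_betw_def)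
  have inj: "d = d'" if "r d = r d'" "d \<in> D" "d' \<in> D" for d d'
    using r(1) that by (auto simp: bij_betw_def inj_on_def)
  have "ip (b (r c)) (b (r d)) = (if c = d then 1 else 0)" if "c \<in> D" "d \<in> D" for c d
    using inj[of c d] nz[of d] orth[of "r c" "r d"] gram_schmidt_self[of w "r d", OF w] that
    by (auto simp: b_def)
  hence 2: "orthonormal I e"
    unfolding orthonormal_def I_def using b by (auto simp: e_Suc)
  have span_e: "span (range b) \<subseteq> span (e ` I)"
  proof (intro span_minimal subspace_span subsetI)
    fix x assume "x \<in> range b"
    then obtain n where n: "x = b n" by blast
    show "x \<in> span (e ` I)"
    proof (cases "b n = 0")
      case False
      then obtain d where "d \<in> D" "n = r d" using r(1) by (auto simp: bij_betw_def)
      hence "x = e (Suc d)" "Suc d \<in> I" using n by (auto simp: e_Suc I_def)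
      thus ?thesis by (auto intro: span_base)
    qed (simp add: n span_zero)
  qed
  have sub: "span (b ` {..n}) \<subseteq> span (e ` I)" for n
    using span_mono[of "b ` {..n}" "range b"] span_e by blast
  have 3: "e i \<in> span (range (cmv_orbit v))" for i
    using b_w[of "r (i - 1)"] span_mono[of "w ` {..r (i - 1)}" "range w"] unfolding e_def w_def by blast
  have 4: "cmv_orbit v n \<in> span (e ` I)" for n using w_b sub w_def by blast
  have 5: "Uinv (e i) \<in> span (e ` I)" for i
    using subsetD[OF sub Uib, of "r (i - 1)"] unfolding e_def .
  \<comment> \<open>\<open>r\<close> never shrinks distances, so new indices more than two apart
    come from old indices more than two apart.\<close>
  have gap: "r i \<ge> r j + n" if "i = j + n" "i \<in> D" for i j n
    using that
  proof (induction n arbitrary: i)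
    case (Suc n)
    have "j + n \<in> D" using Suc.prems D by auto
    with Suc.IH[of "j + n"] have "r (j + n) \<ge> r j + n" by simp
    moreover have "r (j + n) < r i"
      using r(2) \<open>j + n \<in> D\<close> Suc.prems by (auto simp: strict_mono_on_def)
    ultimately show ?case by simp
  qed simp
  have 6: "ip (U (e j)) (e i) = 0" if ij: "i \<in> I" "j \<in> I" and gt: "i > j + 2 \<or> j > i + 2" for i j
  proof -
    obtain c d where cd: "i = Suc c" "j = Suc d" "c \<in> D" "d \<in> D" using ij unfolding I_def by blast
    from gt show ?thesis
    proof
      assume "i > j + 2"
      hence "r c > r d + 2" using gap[of c d "c - d"] cd by auto
      thus ?thesis using far[OF Ub] cd by (simp add: e_Suc)
    next
      assume "j > i + 2"
      hence "r d > r c + 2" using gap[of d c "d - c"] cd by auto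
      \<comment> \<open>Above the diagonal the bound is that of the inverse, moved across by the
        adjoint relation.\<close>
      hence "ip (Uinv (b (r c))) (b (r d)) = 0" by (intro far[OF Uib])
      hence "ip (b (r d)) (Uinv (b (r c))) = 0"
        using inner_commute[of "Uinv (b (r c))" "b (r d)"] b by simp
      thus ?thesis using cd b by (simp add: e_Suc U_adjoint)
    qed
  qed
  show ?thesis using that[OF 1 2 3 4 5 6] by blast
qed

end

section \<open>Five-diagonal representations\<close>

lemma ell2_carrier: "x \<in> hcarrier (ell2 I) \<longleftrightarrow> (\<forall>i. i \<notin> I \<longrightarrow> x i = 0) \<and> (\<lambda>i. (cmod (x i))\<^sup>2) summable_on I"
  by (simp add: ell2_def)
lemma ell2_scale: "hscale (ell2 I) c x = (\<lambda>i. c * x i)"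
  by (simp add: ell2_def)
lemma ell2_inner: "hinner (ell2 I) x y = (\<Sum>\<^sub>\<infinity>i\<in>I. x i * cnj (y i))"
  by (simp add: ell2_def)

text \<open>If \<open>f\<close> is not summable, both sides are 0 by the default value of
  \<open>infsum\<close>; the norm formula for \<open>ell2\<close> can therefore be stated outside
  the carrier as well.\<close>

lemma infsum_complex_of_real: "(\<Sum>\<^sub>\<infinity>i\<in>I. complex_of_real (f i)) = complex_of_real (infsum f I)"
proof (cases "f summable_on I")
  case True
  thus ?thesis by (intro infsumI has_sum_of_real has_sum_infsum)
next
  case False
  moreover have "\<not> (\<lambda>i. complex_of_real (f i)) summable_on I"
    using False summable_on_Re[of "\<lambda>i. complex_of_real (f i)" I] by auto
  ultimately show ?thesis by (simp add: infsum_not_exists)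
qed

lemma ell2_norm_sq: "(hnorm (ell2 I) x)\<^sup>2 = (\<Sum>\<^sub>\<infinity>i\<in>I. (cmod (x i))\<^sup>2)"
proof -
  have "hinner (ell2 I) x x = (\<Sum>\<^sub>\<infinity>i\<in>I. complex_of_real ((cmod (x i))\<^sup>2))"
    unfolding ell2_inner by (intro infsum_cong) (simp only: complex_norm_square)
  also have "\<dots> = complex_of_real (\<Sum>\<^sub>\<infinity>i\<in>I. (cmod (x i))\<^sup>2)"
    by (simp only: infsum_complex_of_real)
  finally show ?thesis by (simp add: hnorm_def infsum_nonneg)
qed

lemma ell2_inner_canonical:
  assumes "i \<in> I"
  shows "hinner (ell2 I) x (canonical_vec i) = x i"
proof -
  have "((\<lambda>k. x k * cnj (canonical_vec i k)) has_sum x i) I"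
    using assms by (intro has_sum_finite_neutralI[of "{i}"]) (auto simp: canonical_vec_def)
  thus ?thesis unfolding ell2_inner by (rule infsumI)
qed

lemma canonical_vec_carrier: "j \<in> I \<Longrightarrow> canonical_vec j \<in> hcarrier (ell2 I)"
proof -
  assume j: "j \<in> I"
  have "((\<lambda>k. (cmod (canonical_vec j k))\<^sup>2) has_sum 1) I"
    using j by (intro has_sum_finite_neutralI[of "{j}"]) (auto simp: canonical_vec_def)
  thus ?thesis using j by (auto simp: ell2_carrier canonical_vec_def summable_on_def)
qed

section \<open>Coordinates with respect to an orthonormal family\<close>

context complex_hilbert_space
begin

text \<open>The value 0 off \<open>I\<close> is what membership in \<open>ell2 I\<close>
  demands.\<close>

definition coords :: "'i set \<Rightarrow> ('i \<Rightarrow> 'v) \<Rightarrow> 'v \<Rightarrow> 'i \<Rightarrow> complex" where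
  "coords I e x = (\<lambda>i. if i \<in> I then ip x (e i) else 0)"

lemma coords_norm_summable:
  assumes "orthonormal I e" "x \<in> carr"
  shows "(\<lambda>i. (cmod (coords I e x i))\<^sup>2) summable_on I"
  using bessel_summable[OF assms]
  by (subst summable_on_cong[where g="\<lambda>i. (cmod (ip x (e i)))\<^sup>2"]) (auto simp: coords_def)

lemma coords_carrier:
  assumes "orthonormal I e" "x \<in> carr"
  shows "coords I e x \<in> hcarrier (ell2 I)"
  using coords_norm_summable[OF assms] by (simp add: ell2_carrier) (simp add: coords_def)

lemma coords_norm_le:
  assumes "orthonormal I e" "x \<in> carr"
  shows "hnorm (ell2 I) (coords I e x) \<le> nm x"
proof (rule power2_le_imp_le)
  have "(hnorm (ell2 I) (coords I e x))\<^sup>2 = (\<Sum>\<^sub>\<infinity>i\<in>I. (cmod (ip x (e i)))\<^sup>2)"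
    unfolding ell2_norm_sq by (intro infsum_cong) (simp add: coords_def)
  thus "(hnorm (ell2 I) (coords I e x))\<^sup>2 \<le> (nm x)\<^sup>2" using bessel[OF assms] by simp
qed (use assms in simp)

text \<open>Evaluating the Riesz-Fischer expansion at \<open>z\<close> itself gives the equality of
  norms, from which block operators inherit the bound 1.\<close>

lemma coords_surj:
  fixes e :: "'i::countable \<Rightarrow> 'v"
  assumes on: "orthonormal I e" and y: "y \<in> hcarrier (ell2 I)"
  shows "\<exists>z\<in>carr. coords I e z = y \<and> nm z = hnorm (ell2 I) y"
proof -
  obtain z where z: "z \<in> carr"
    "\<And>x. x \<in> carr \<Longrightarrow> ((\<lambda>k. y k * ip (e k) x) has_sum ip z x) I"
    "\<And>k. k \<in> I \<Longrightarrow> ip z (e k) = y k"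
    using riesz_fischer[OF on, of y] y by (auto simp: ell2_carrier)
  have "ip (e k) z = cnj (y k)" if "k \<in> I" for k
    using inner_commute[OF z(1) orthonormal_mem[OF on that]] z(3)[OF that] by simp
  hence "((\<lambda>k. y k * cnj (y k)) has_sum ip z z) I"
    using z(2)[OF z(1)] by (subst has_sum_cong[where g="\<lambda>k. y k * ip (e k) z"]) auto
  hence "hinner (ell2 I) y y = ip z z" unfolding ell2_inner by (rule infsumI)
  moreover have "coords I e z = y" using z(3) y by (auto simp: coords_def ell2_carrier)
  ultimately show ?thesis using z(1) by (auto simp: hnorm_def)
qed

text \<open>Distinct orthonormal vectors have distance \<open>sqrt 2\<close>, so approximations
  within 1/2 from a countable dense set are distinct.\<close>

lemma orthonormal_countable:
  assumes sep: "separable_hilbert H" and M: "orthonormal M (\<lambda>x. x)"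
  shows "countable M"
proof -
  obtain D where D: "countable D" "D \<subseteq> carr" "\<And>x e. x \<in> carr \<Longrightarrow> e > 0 \<Longrightarrow> \<exists>d\<in>D. nm (x - d) < e"
    using sep unfolding separable_hilbert_def by blast
  have Mc: "x \<in> carr" if "x \<in> M" for x using orthonormal_mem[OF M that] .
  define d where "d x = (SOME d. d \<in> D \<and> nm (x - d) < 1 / 2)" for x
  have d: "d x \<in> D \<and> nm (x - d x) < 1 / 2" if "x \<in> M" for x
    unfolding d_def by (rule someI_ex) (use D(3)[OF Mc[OF that], of "1 / 2"] in auto)
  have "inj_on d M"
  proof (rule inj_onI, rule ccontr)
    fix x y assume xy: "x \<in> M" "y \<in> M" "d x = d y" "x \<noteq> y"
    have dc: "d x \<in> carr" using d[OF xy(1)] D(2) by auto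
    have "nm (x - y) \<le> nm (x - d x) + nm (d x - y)"
      using nm_triangle[of "x - d x" "d x - y"] Mc xy dc by simp
    also have "\<dots> < 1" using d[OF xy(1)] d[OF xy(2)] xy(3) nm_minus[OF dc Mc[OF xy(2)]] by simp
    finally have "nm (x - y) < 1" .
    hence "(nm (x - y))\<^sup>2 < 1" using nm_nonneg[of "x - y"] Mc xy by (simp add: power_less_one_iff abs_square_less_1)
    moreover have "ip (x - y) (x - y) = 2"
      using xy Mc orthonormal_ip[OF M xy(1,2)] orthonormal_ip[OF M xy(2,1)]
        orthonormal_ip[OF M xy(1,1)] orthonormal_ip[OF M xy(2,2)]
      by (simp add: ip_diff_left ip_diff_right)
    hence "(nm (x - y))\<^sup>2 = 2" using xy Mc nm_sq[of "x - y"] by simp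
    ultimately show False by simp
  qed
  moreover have "d ` M \<subseteq> D" using d by auto
  ultimately show ?thesis using D(1) by (meson countable_image_inj_on countable_subset)
qed

end

section \<open>Decomposition into cyclic blocks\<close>

context hilbert_unitary
begin

text \<open>The coordinates of \<open>U x\<close> depend only on those of \<open>x\<close>:
  \<open>ip (U x) (e i)\<close> equals \<open>ip x (Uinv (e i))\<close>, and
  \<open>Uinv (e i)\<close> is a finite combination of the family. Hence \<open>U\<close> descends
  to coordinate families.\<close>

lemma block_operator:
  fixes e :: "nat \<Rightarrow> 'v"
  assumes on: "orthonormal I e" and inv: "\<And>i. i \<in> I \<Longrightarrow> Uinv (e i) \<in> span (e ` I)"
  obtains A where "bounded_operator (ell2 I) A"
    "\<And>x. x \<in> carr \<Longrightarrow> A (coords I e x) = coords I e (U x)"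
proof -
  have ec: "e ` I \<subseteq> carr" using orthonormal_mem[OF on] by blast
  have eq: "coords I e (U x) = coords I e (U y)"
    if xy: "x \<in> carr" "y \<in> carr" "coords I e x = coords I e y" for x y
  proof
    fix i
    show "coords I e (U x) i = coords I e (U y) i"
    proof (cases "i \<in> I")
      case True
      have "ip (e k) (x - y) = 0" if "k \<in> I" for k
        using fun_cong[OF xy(3), of k] that xy(1,2) orthonormal_mem[OF on that]
          inner_commute[of "x - y" "e k"]
        by (simp add: coords_def ip_diff_left)
      hence "ip (Uinv (e i)) (x - y) = 0"
        using xy(1,2) by (intro span_orthogonal[OF ec _ _ inv[OF True]]) auto
      hence "ip (x - y) (Uinv (e i)) = 0"
        using inner_commute[of "Uinv (e i)" "x - y"] xy orthonormal_mem[OF on True] by simp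
      thus ?thesis using xy True orthonormal_mem[OF on True]
        by (simp add: coords_def U_adjoint ip_diff_left)
    qed (simp add: coords_def)
  qed
  \<comment> \<open>Any preimage gives the same operator, by \<open>eq\<close>; one of equal norm
    makes the bound 1 immediate.\<close>
  define R where "R y = (SOME z. z \<in> carr \<and> coords I e z = y \<and> nm z = hnorm (ell2 I) y)" for y
  have R: "R y \<in> carr" "coords I e (R y) = y" "nm (R y) = hnorm (ell2 I) y"
    if "y \<in> hcarrier (ell2 I)" for y
    using someI_ex[OF coords_surj[OF on that, unfolded Bex_def]] unfolding R_def by blast+
  define A where "A y = coords I e (U (R y))" for y
  have A: "A (coords I e x) = coords I e (U x)" if "x \<in> carr" for x
    unfolding A_def using that R[OF coords_carrier[OF on that]] by (intro eq) auto
  have add: "coords I e (x + y) = coords I e x + coords I e y" if "x \<in> carr" "y \<in> carr" for x y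
    using that orthonormal_mem[OF on] by (auto simp: coords_def fun_eq_iff inner_add_left)
  have scale: "coords I e (c *\<^sub>H x) = hscale (ell2 I) c (coords I e x)" if "x \<in> carr" for c x
    using that orthonormal_mem[OF on] by (auto simp: coords_def fun_eq_iff inner_scale_left ell2_scale)
  have "bounded_operator (ell2 I) A"
    unfolding bounded_operator_def linear_map_on_def
  proof (intro conjI ballI allI exI[of _ 1])
    fix x assume x: "x \<in> hcarrier (ell2 I)"
    show "A x \<in> hcarrier (ell2 I)" unfolding A_def using R[OF x] by (intro coords_carrier on) simp
    show "hnorm (ell2 I) (A x) \<le> 1 * hnorm (ell2 I) x"
      unfolding A_def using coords_norm_le[OF on, of "U (R x)"] R[OF x] by (simp add: U_nm)
    fix y assume y: "y \<in> hcarrier (ell2 I)"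
    have "A (x + y) = A (coords I e (R x + R y))" using R[OF x] R[OF y] by (simp add: add)
    also have "\<dots> = A x + A y"
      using R[OF x] R[OF y] by (subst A) (simp_all add: U_add add A_def)
    finally show "A (x + y) = A x + A y" .
  next
    fix c x assume x: "x \<in> hcarrier (ell2 I)"
    have "A (hscale (ell2 I) c x) = A (coords I e (c *\<^sub>H R x))" using R[OF x] by (simp add: scale)
    also have "\<dots> = hscale (ell2 I) c (A x)"
      using R[OF x] by (subst A) (simp_all add: U_scale scale A_def)
    finally show "A (hscale (ell2 I) c x) = hscale (ell2 I) c (A x)" .
  qed
  thus ?thesis using A that by blast
qed

text \<open>The members generate pairwise orthogonal reducing subspaces; unit norm makes the family
  orthonormal, hence countable in a separable space.\<close>

definition orbit_orthonormal :: "'v set \<Rightarrow> bool" where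
  "orbit_orthonormal S \<longleftrightarrow> S \<subseteq> carr \<and> (\<forall>x\<in>S. nm x = 1) \<and>
     (\<forall>x\<in>S. \<forall>y\<in>S. x \<noteq> y \<longrightarrow> (\<forall>m n. ip (cmv_orbit x m) (cmv_orbit y n) = 0))"

lemma orbit_orthonormal_imp: "orbit_orthonormal S \<Longrightarrow> orthonormal S (\<lambda>x. x)"
  unfolding orthonormal_def orbit_orthonormal_def
  by (auto simp: ip_eq_nm subset_iff) (metis cmv_orbit_0)

text \<open>Powers applied to \<open>y\<close> are moved to the other argument one at a time, where
  the orbit of \<open>x\<close> absorbs them; the inductions therefore treat all indices of that
  orbit at once.\<close>

lemma cmv_orbit_orthogonal:
  assumes x: "x \<in> carr" and y: "y \<in> carr" and o: "\<And>m. ip (cmv_orbit x m) y = 0"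
  shows "ip (cmv_orbit x m) (cmv_orbit y n) = 0"
proof -
  note m = cmv_orbit_mem[OF x]
  have "\<forall>m. ip (cmv_orbit x m) ((U ^^ k) y) = 0" for k
  proof (induction k)
    case (Suc k)
    show ?case
    proof
      fix j
      obtain j' where "Uinv (cmv_orbit x j) = cmv_orbit x j'" using Uinv_cmv_orbit[OF x, of j] by blast
      thus "ip (cmv_orbit x j) ((U ^^ Suc k) y) = 0"
        using Suc Uinv_adjoint[OF m U_pow_mem[OF y], of j k] by simp
    qed
  qed (simp add: o)
  moreover have "\<forall>m. ip (cmv_orbit x m) ((Uinv ^^ k) y) = 0" for k
  proof (induction k)
    case (Suc k)
    show ?case
    proof
      fix j
      obtain j' where "U (cmv_orbit x j) = cmv_orbit x j'" using U_cmv_orbit[OF x, of j] by blast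
      thus "ip (cmv_orbit x j) ((Uinv ^^ Suc k) y) = 0"
        using Suc U_adjoint[OF m Uinv_pow_mem[OF y], of j k] by simp
    qed
  qed (simp add: o)
  ultimately show ?thesis unfolding cmv_orbit_def[of y] by presburger
qed

text \<open>A nonzero vector orthogonal to all the orbits could be normalised and adjoined, since
  its whole orbit is then orthogonal to them.\<close>

lemma maximal_orbit_family:
  obtains M where "orbit_orthonormal M"
    "\<And>y. y \<in> carr \<Longrightarrow> (\<And>x n. x \<in> M \<Longrightarrow> ip (cmv_orbit x n) y = 0) \<Longrightarrow> y = 0"
proof -
  have "\<exists>M\<in>Collect orbit_orthonormal. \<forall>X\<in>Collect orbit_orthonormal. M \<subseteq> X \<longrightarrow> X = M"
  proof (rule subset_Zorn')
    fix C assume C: "subset.chain (Collect orbit_orthonormal) C"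
    hence o: "\<And>S. S \<in> C \<Longrightarrow> orbit_orthonormal S" unfolding subset.chain_def by blast
    have c: "\<And>S T. S \<in> C \<Longrightarrow> T \<in> C \<Longrightarrow> S \<subseteq> T \<or> T \<subseteq> S"
      using C unfolding subset.chain_def by blast
    have "ip (cmv_orbit x m) (cmv_orbit y n) = 0" if "x \<in> S" "S \<in> C" "y \<in> T" "T \<in> C" "x \<noteq> y" for x y S T m n
      using c[OF that(2,4)] o[OF that(2)] o[OF that(4)] that unfolding orbit_orthonormal_def by blast
    hence "\<forall>x\<in>\<Union>C. \<forall>y\<in>\<Union>C. x \<noteq> y \<longrightarrow> (\<forall>m n. ip (cmv_orbit x m) (cmv_orbit y n) = 0)"
      by (meson UnionE)
    moreover have "\<Union>C \<subseteq> carr" "\<forall>x\<in>\<Union>C. nm x = 1"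
      using o unfolding orbit_orthonormal_def by (meson Sup_least, meson UnionE)
    ultimately show "\<Union>C \<in> Collect orbit_orthonormal"
      by (simp only: orbit_orthonormal_def mem_Collect_eq)
  qed
  then obtain M where M: "orbit_orthonormal M" and max: "\<And>X. orbit_orthonormal X \<Longrightarrow> M \<subseteq> X \<Longrightarrow> X = M"
    by blast
  have "y = 0" if y: "y \<in> carr" "\<And>x n. x \<in> M \<Longrightarrow> ip (cmv_orbit x n) y = 0" for y
  proof (rule ccontr)
    assume "y \<noteq> 0"
    define u where "u = complex_of_real (1 / nm y) *\<^sub>H y"
    have u: "u \<in> carr" "nm u = 1" unfolding u_def using y normalize_nm[OF y(1) \<open>y \<noteq> 0\<close>] by auto
    have Mc: "x \<in> carr" if "x \<in> M" for x using M that by (auto simp: orbit_orthonormal_def)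
    have "ip (cmv_orbit x n) u = 0" if "x \<in> M" for x n
      unfolding u_def using y cmv_orbit_mem[OF Mc[OF that]] that by (simp add: ip_scale_right)
    hence xu: "ip (cmv_orbit x m) (cmv_orbit u n) = 0" if "x \<in> M" for x m n
      using that by (intro cmv_orbit_orthogonal Mc u) auto
    hence ux: "ip (cmv_orbit u n) (cmv_orbit x m) = 0" if "x \<in> M" for x m n
      using inner_commute[OF cmv_orbit_mem[OF Mc[OF that]] cmv_orbit_mem[OF u(1)]] xu[OF that] by simp
    have "orbit_orthonormal (insert u M)"
      using M u xu ux unfolding orbit_orthonormal_def by auto
    hence "insert u M = M" by (rule max) blast
    hence "u \<in> M" by blast
    from xu[OF this, of 0 0] u show False by (simp add: cmv_orbit_0 ip_eq_nm)
  qed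
  thus ?thesis using M that by blast
qed

lemma five_diagonal_representation:
  assumes sep: "separable_hilbert H"
  shows "has_n_diagonal_representation 5 H U"
proof -
  obtain M where M: "orbit_orthonormal M"
    "\<And>y. y \<in> carr \<Longrightarrow> (\<And>x n. x \<in> M \<Longrightarrow> ip (cmv_orbit x n) y = 0) \<Longrightarrow> y = 0"
    by (rule maximal_orbit_family) blast
  have cM: "countable M" using orthonormal_countable[OF sep orbit_orthonormal_imp[OF M(1)]] .
  \<comment> \<open>Orthogonal sums are indexed by natural numbers, so the members of
    \<open>M\<close> are represented by their codes.\<close>
  define J where "J = to_nat_on M ` M"
  define v where "v j = from_nat_into M j" for j
  have vM: "v j \<in> M" if "j \<in> J" for j
    using that cM by (auto simp: v_def J_def)
  have vinj: "v i \<noteq> v j" if "i \<in> J" "j \<in> J" "i \<noteq> j" for i j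
    using that cM by (auto simp: v_def J_def)
  have vsurj: "\<exists>j\<in>J. v j = x" if "x \<in> M" for x
    using that cM by (auto simp: v_def J_def)
  have vc: "v j \<in> carr" "v j \<noteq> 0" if "j \<in> J" for j
    using vM[OF that] M(1) nm_eq_0[OF zero_mem] by (auto simp: orbit_orthonormal_def)
  \<comment> \<open>One predicate for all properties of the basis, so that a single choice supplies
    \<open>I\<close> and \<open>f\<close> for every \<open>j\<close>.\<close>
  define P where "P j I e \<longleftrightarrow> matrix_index_set I \<and> orthonormal I e \<and>
      (\<forall>i\<in>I. e i \<in> span (range (cmv_orbit (v j)))) \<and>
      (\<forall>n. cmv_orbit (v j) n \<in> span (e ` I)) \<and>
      (\<forall>i\<in>I. Uinv (e i) \<in> span (e ` I)) \<and>
      (\<forall>i\<in>I. \<forall>k\<in>I. i > k + 2 \<or> k > i + 2 \<longrightarrow> ip (U (e k)) (e i) = 0)" for j I e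
  have "\<forall>j\<in>J. \<exists>I e. P j I e"
  proof
    fix j assume "j \<in> J"
    from cmv_basis[OF vc[OF this]] show "\<exists>I e. P j I e" unfolding P_def by metis
  qed
  then obtain I f where P: "\<And>j. j \<in> J \<Longrightarrow> P j (I j) (f j)" by metis
  have mI: "matrix_index_set (I j)" and onj: "orthonormal (I j) (f j)" if "j \<in> J" for j
    using P[OF that] unfolding P_def by blast+
  have "\<forall>j\<in>J. \<exists>A. bounded_operator (ell2 (I j)) A \<and>
      (\<forall>x\<in>carr. A (coords (I j) (f j) x) = coords (I j) (f j) (U x))"
  proof
    fix j assume j: "j \<in> J"
    have inv: "Uinv (f j i) \<in> span (f j ` I j)" if "i \<in> I j" for i
      using P[OF j] that unfolding P_def by blast
    show "\<exists>A. bounded_operator (ell2 (I j)) A \<and>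
      (\<forall>x\<in>carr. A (coords (I j) (f j) x) = coords (I j) (f j) (U x))"
      by (rule block_operator[OF onj[OF j] inv]) blast+
  qed
  then obtain A where Ab: "\<And>j. j \<in> J \<Longrightarrow> bounded_operator (ell2 (I j)) (A j)"
    and Ac: "\<And>j x. j \<in> J \<Longrightarrow> x \<in> carr \<Longrightarrow> A j (coords (I j) (f j) x) = coords (I j) (f j) (U x)"
    by metis
  \<comment> \<open>The block bases together form one orthonormal family indexed by pairs, to which
    Riesz-Fischer and Parseval apply.\<close>
  define K where "K = Sigma J I"
  define e where "e = (\<lambda>(j, i). f j i)"
  have fc: "f j i \<in> carr" if "j \<in> J" "i \<in> I j" for i j
    using orthonormal_mem[OF onj] that by blast
  have orb_sub: "range (cmv_orbit (v j)) \<subseteq> carr" if "j \<in> J" for j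
    using cmv_orbit_mem[OF vc(1)[OF that]] by blast
  \<comment> \<open>Orthogonality is carried from the orbits to their spans one argument at a
    time.\<close>
  have cross: "ip (f j i) (f k l) = 0" if "j \<in> J" "k \<in> J" "j \<noteq> k" "i \<in> I j" "l \<in> I k" for i j k l
  proof -
    have s: "f j i \<in> span (range (cmv_orbit (v j)))" "f k l \<in> span (range (cmv_orbit (v k)))"
      using P[OF that(1)] P[OF that(2)] that unfolding P_def by blast+
    have "ip (cmv_orbit (v j) m) (cmv_orbit (v k) n) = 0" for m n
      using M(1) vM[OF that(1)] vM[OF that(2)] vinj[OF that(1-3)] unfolding orbit_orthonormal_def by blast
    hence "ip (f j i) (cmv_orbit (v k) n) = 0" for n
      using orb_sub[OF that(1)] cmv_orbit_mem[OF vc(1)[OF that(2)]]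
      by (intro span_orthogonal[OF _ _ _ s(1)]) auto
    hence "ip (cmv_orbit (v k) n) (f j i) = 0" for n
      using inner_commute[OF fc[OF that(1,4)] cmv_orbit_mem[OF vc(1)[OF that(2)]], of n] by simp
    hence "ip (f k l) (f j i) = 0"
      using orb_sub[OF that(2)] fc[OF that(1,4)]
      by (intro span_orthogonal[OF _ _ _ s(2)]) auto
    thus ?thesis using inner_commute[OF fc[OF that(2,5)] fc[OF that(1,4)]] by simp
  qed
  have "ip (f j i) (f k l) = (if (j, i) = (k, l) then 1 else 0)"
    if "j \<in> J" "k \<in> J" "i \<in> I j" "l \<in> I k" for i j k l
    using cross[OF that(1,2) _ that(3,4)] orthonormal_ip[OF onj[OF that(1)], of i l] that
    by (cases "j = k") auto
  hence on: "orthonormal K e"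
    unfolding orthonormal_def K_def e_def using fc by auto
  have total: "y = 0" if y: "y \<in> carr" "\<And>k. k \<in> K \<Longrightarrow> ip y (e k) = 0" for y
  proof (rule M(2)[OF y(1)])
    fix x n assume "x \<in> M"
    then obtain j where j: "j \<in> J" "v j = x" using vsurj by blast
    have s: "cmv_orbit x n \<in> span (f j ` I j)" using P[OF j(1)] j(2) unfolding P_def by blast
    have "ip (f j i) y = 0" if "i \<in> I j" for i
      using y(2)[of "(j, i)"] inner_commute[OF y(1) fc[OF j(1) that]] j that by (simp add: K_def e_def)
    thus "ip (cmv_orbit x n) y = 0"
      using fc[OF j(1)] y by (intro span_orthogonal[OF _ _ _ s]) auto
  qed
  define W where "W x = (\<lambda>j. if j \<in> J then coords (I j) (f j) x else 0)" for x
  let ?L = "hilbert_sum J (\<lambda>j. ell2 (I j))"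
  \<comment> \<open>Parseval's identity over all pairs, summed first inside each block.\<close>
  have pars: "((\<lambda>j. hinner (ell2 (I j)) (W x j) (W y j)) has_sum ip x y) J"
    if x: "x \<in> carr" and y: "y \<in> carr" for x y
  proof (rule has_sum_Sigma'[OF parseval[OF on total x y, unfolded K_def]])
    fix j assume j: "j \<in> J"
    have "(\<lambda>i. W x j i * cnj (W y j i)) summable_on I j"
      using coords_norm_summable[OF onj[OF j] x] coords_norm_summable[OF onj[OF j] y] j
      by (intro square_summable_mult) (simp_all add: W_def)
    hence "((\<lambda>i. W x j i * cnj (W y j i)) has_sum hinner (ell2 (I j)) (W x j) (W y j)) (I j)"
      unfolding ell2_inner by (rule has_sum_infsum)
    thus "((\<lambda>i. ip x (e (j, i)) * cnj (ip y (e (j, i)))) has_sum hinner (ell2 (I j)) (W x j) (W y j)) (I j)"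
      using j by (subst has_sum_cong[where g="\<lambda>i. W x j i * cnj (W y j i)"]) (auto simp: W_def coords_def e_def)
  qed
  have Wc: "W x \<in> hcarrier ?L" if x: "x \<in> carr" for x
  proof -
    have "(\<lambda>j. (hnorm (ell2 (I j)) (W x j))\<^sup>2) summable_on J"
    proof -
      \<comment> \<open>The case \<open>x = y\<close> of \<open>pars\<close>, a complex sum whose
        terms are the real squared norms.\<close>
      have "((\<lambda>j. complex_of_real ((hnorm (ell2 (I j)) (W x j))\<^sup>2)) has_sum complex_of_real ((nm x)\<^sup>2)) J"
      proof (subst has_sum_cong)
        fix j assume j: "j \<in> J"
        have "hinner (ell2 (I j)) (W x j) (W x j) = (\<Sum>\<^sub>\<infinity>i\<in>I j. complex_of_real ((cmod (W x j i))\<^sup>2))"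
          unfolding ell2_inner by (intro infsum_cong) (simp only: complex_norm_square)
        thus "complex_of_real ((hnorm (ell2 (I j)) (W x j))\<^sup>2) = hinner (ell2 (I j)) (W x j) (W x j)"
          by (simp only: infsum_complex_of_real ell2_norm_sq)
      next
        show "((\<lambda>j. hinner (ell2 (I j)) (W x j) (W x j)) has_sum complex_of_real ((nm x)\<^sup>2)) J"
          using pars[OF x x] ip_eq_nm[OF x] by simp
      qed
      thus ?thesis by (simp only: has_sum_of_real_iff) (auto simp: summable_on_def)
    qed
    thus ?thesis using coords_carrier[OF onj x] by (simp add: hilbert_sum_def W_def)
  qed
  have um: "unitary_map H ?L W"
    unfolding unitary_map_def linear_map_on_def
  proof (intro conjI ballI allI)
    fix x y assume "x \<in> carr" "y \<in> carr"
    thus "hinner ?L (W x) (W y) = ip x y"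
      using infsumI[OF pars, of x y] by (simp add: hilbert_sum_def)
    show "W (x + y) = W x + W y"
      using \<open>x \<in> carr\<close> \<open>y \<in> carr\<close> fc
      by (auto simp: W_def coords_def fun_eq_iff inner_add_left)
  next
    fix c x assume "x \<in> carr"
    thus "W (c *\<^sub>H x) = hscale ?L c (W x)"
      using fc by (auto simp: W_def coords_def fun_eq_iff inner_scale_left hilbert_sum_def ell2_scale)
  next
    show "W ` carr = hcarrier ?L"
    proof (intro antisym subsetI)
      fix y assume y: "y \<in> hcarrier ?L"
      have yj: "y j \<in> hcarrier (ell2 (I j))" if "j \<in> J" for j
        using y that by (simp add: hilbert_sum_def)
      have y0: "y j = 0" if "j \<notin> J" for j using y that by (simp add: hilbert_sum_def)
      \<comment> \<open>For surjectivity the blocks of \<open>y\<close> are flattened to one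
        square-summable family on \<open>K\<close>, whose Riesz-Fischer vector is the
        preimage.\<close>
      have sm: "(\<lambda>k. (cmod (y (fst k) (snd k)))\<^sup>2) summable_on K"
        unfolding K_def
      proof (rule summable_on_SigmaI)
        show "(\<lambda>j. (hnorm (ell2 (I j)) (y j))\<^sup>2) summable_on J"
          using y by (simp add: hilbert_sum_def)
        fix j assume "j \<in> J"
        thus "((\<lambda>i. (cmod (y (fst (j, i)) (snd (j, i))))\<^sup>2) has_sum (hnorm (ell2 (I j)) (y j))\<^sup>2) (I j)"
          using yj[of j] by (simp add: ell2_norm_sq ell2_carrier)
      qed simp
      obtain z where z: "z \<in> carr" "\<And>k. k \<in> K \<Longrightarrow> ip z (e k) = y (fst k) (snd k)"
        by (rule riesz_fischer[OF on sm]) fast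
      have "W z = y"
      proof
        fix j
        show "W z j = y j"
        proof (cases "j \<in> J")
          case True
          have "ip z (f j i) = y j i" if "i \<in> I j" for i
            using z(2)[of "(j, i)"] True that by (simp add: K_def e_def)
          thus ?thesis using True yj[OF True] by (auto simp: W_def coords_def ell2_carrier)
        qed (simp add: W_def y0)
      qed
      thus "y \<in> W ` carr" using z(1) by blast
    qed (use Wc in blast)
  qed (use Wc in blast)
  have inter: "W (U x) = operator_sum J A (W x)" if "x \<in> carr" for x
    using that Ac by (auto simp: W_def operator_sum_def)
  have "\<exists>c. n_diagonal 5 (I j) c \<and> given_by_matrix (I j) c (A j)" if j: "j \<in> J" for j
  proof -
    define c where "c i k = hinner (ell2 (I j)) (A j (canonical_vec k)) (canonical_vec i)" for i k
    \<comment> \<open>\<open>canonical_vec k\<close> is the coordinate family of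
      \<open>f j k\<close>, so the matrix entries are inner products in \<open>H\<close>.\<close>
    have c: "c i k = ip (U (f j k)) (f j i)" if "i \<in> I j" "k \<in> I j" for i k
    proof -
      have "canonical_vec k = coords (I j) (f j) (f j k)"
        using that orthonormal_ip[OF onj[OF j]] by (auto simp: canonical_vec_def coords_def)
      thus ?thesis unfolding c_def ell2_inner_canonical[OF that(1)]
        using that Ac[OF j fc[OF j that(2)]] by (simp add: coords_def)
    qed
    have "pq_diagonal 2 2 (I j) c"
      unfolding pq_diagonal_def
    proof (intro ballI impI)
      fix i k assume ik: "i \<in> I j" "k \<in> I j" "int i - int k > int 2 \<or> int k - int i > int 2"
      hence "i > k + 2 \<or> k > i + 2" by auto
      thus "c i k = 0" using P[OF j] ik c unfolding P_def by auto
    qed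
    hence "n_diagonal 5 (I j) c" by (simp add: n_diagonal_def)
    moreover have "given_by_matrix (I j) c (A j)"
      using Ab[OF j] by (simp add: given_by_matrix_def c_def)
    ultimately show ?thesis by blast
  qed
  thus ?thesis
    unfolding has_n_diagonal_representation_def unitarily_equivalent_def
    using mI um inter by blast
qed

end

section \<open>The Hilbert space of square-summable families\<close>

lemma square_summable_add:
  fixes f g :: "'i \<Rightarrow> complex"
  assumes "(\<lambda>i. (cmod (f i))\<^sup>2) summable_on K" "(\<lambda>i. (cmod (g i))\<^sup>2) summable_on K"
  shows "(\<lambda>i. (cmod (f i + g i))\<^sup>2) summable_on K"
proof (rule summable_on_comparison_test)
  show "(\<lambda>i. 2 * (cmod (f i))\<^sup>2 + 2 * (cmod (g i))\<^sup>2) summable_on K"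
    using assms by (intro summable_on_add summable_on_cmult_right)
  fix i
  have "(cmod (f i + g i))\<^sup>2 \<le> (cmod (f i) + cmod (g i))\<^sup>2"
    by (intro power_mono norm_triangle_ineq) simp
  also have "\<dots> \<le> 2 * (cmod (f i))\<^sup>2 + 2 * (cmod (g i))\<^sup>2"
    using sum_squares_bound[of "cmod (f i)" "cmod (g i)"] by (simp add: power2_sum)
  finally show "(cmod (f i + g i))\<^sup>2 \<le> 2 * (cmod (f i))\<^sup>2 + 2 * (cmod (g i))\<^sup>2" .
qed simp

lemma square_summable_scale:
  fixes f :: "'i \<Rightarrow> complex"
  shows "(\<lambda>i. (cmod (f i))\<^sup>2) summable_on K \<Longrightarrow> (\<lambda>i. (cmod (c * f i))\<^sup>2) summable_on K"
  by (simp add: norm_mult power_mult_distrib summable_on_cmult_right)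

lemma ell2_inner_summable:
  assumes "x \<in> hcarrier (ell2 I)" "y \<in> hcarrier (ell2 I)"
  shows "(\<lambda>i. x i * cnj (y i)) summable_on I"
  using assms by (intro square_summable_mult) (simp_all add: ell2_carrier)

lemma ell2_coord_le:
  assumes "x \<in> hcarrier (ell2 I)"
  shows "cmod (x i) \<le> hnorm (ell2 I) x"
proof (cases "i \<in> I")
  case True
  have "(\<Sum>i\<in>{i}. (cmod (x i))\<^sup>2) \<le> (\<Sum>\<^sub>\<infinity>i\<in>I. (cmod (x i))\<^sup>2)"
    using assms True by (intro finite_sum_le_infsum) (auto simp: ell2_carrier)
  hence "(cmod (x i))\<^sup>2 \<le> (hnorm (ell2 I) x)\<^sup>2" by (simp add: ell2_norm_sq)
  moreover have "0 \<le> hnorm (ell2 I) x"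
    unfolding hnorm_def ell2_inner complex_mult_cnj
    by (simp only: infsum_complex_of_real) (auto intro!: infsum_nonneg)
  ultimately show ?thesis by (rule power2_le_imp_le)
next
  case False
  moreover have "0 \<le> hnorm (ell2 I) x"
    unfolding hnorm_def ell2_inner complex_mult_cnj
    by (simp only: infsum_complex_of_real) (auto intro!: infsum_nonneg)
  ultimately show ?thesis using assms by (simp add: ell2_carrier)
qed

text \<open>For completeness the limit is taken coordinatewise; bounds on finite index sets survive
  it and add up to a bound on the norm.\<close>

theorem complex_hilbert_space_ell2: "complex_hilbert_space (ell2 I)"
proof -
  have vs: "vector_space (hscale (ell2 I))"
    by unfold_locales (auto simp: ell2_scale fun_eq_iff algebra_simps)
  interpret vector_space "hscale (ell2 I)" by (rule vs)
  have sub: "subspace (hcarrier (ell2 I))"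
    unfolding subspace_def
    by (auto simp: ell2_carrier ell2_scale intro: square_summable_add square_summable_scale)
  show ?thesis
  proof unfold_locales
    show "subspace (hcarrier (ell2 I))" by (rule sub)
  next
    fix x y z assume "x \<in> hcarrier (ell2 I)" "y \<in> hcarrier (ell2 I)" "z \<in> hcarrier (ell2 I)"
    thus "hinner (ell2 I) (x + y) z = hinner (ell2 I) x z + hinner (ell2 I) y z"
      unfolding ell2_inner by (simp add: distrib_right infsum_add ell2_inner_summable)
  next
    fix x y c
    show "hinner (ell2 I) (hscale (ell2 I) c x) y = c * hinner (ell2 I) x y"
      unfolding ell2_inner ell2_scale by (simp add: mult.assoc infsum_cmult_right')
  next
    fix x y
    show "hinner (ell2 I) y x = cnj (hinner (ell2 I) x y)"
      unfolding ell2_inner infsum_cnj[symmetric] by (intro infsum_cong) simp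
  next
    fix x :: "'a \<Rightarrow> complex" assume x: "x \<in> hcarrier (ell2 I)" "x \<noteq> 0"
    then obtain i where i: "x i \<noteq> 0" by (auto simp: fun_eq_iff)
    have "0 < hnorm (ell2 I) x" using ell2_coord_le[OF x(1), of i] i
      by (smt (verit) zero_less_norm_iff)
    thus "0 < Re (hinner (ell2 I) x x)" by (simp add: hnorm_def)
  next
    fix s :: "nat \<Rightarrow> 'a \<Rightarrow> complex"
    assume s: "\<And>n. s n \<in> hcarrier (ell2 I)"
      and C: "\<forall>e>0. \<exists>N. \<forall>m\<ge>N. \<forall>n\<ge>N. hnorm (ell2 I) (s m - s n) < e"
    have d: "s m - s n \<in> hcarrier (ell2 I)" for m n using sub s by (intro subspace_diff)
    have "Cauchy (\<lambda>n. s n i)" for i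
      unfolding Cauchy_def
    proof (intro allI impI)
      fix e :: real assume "e > 0"
      with C obtain N where N: "\<And>m n. m \<ge> N \<Longrightarrow> n \<ge> N \<Longrightarrow> hnorm (ell2 I) (s m - s n) < e" by blast
      have "dist (s m i) (s n i) < e" if "m \<ge> N" "n \<ge> N" for m n
        using ell2_coord_le[OF d, of m n i] N[OF that] by (simp add: dist_norm)
      thus "\<exists>M. \<forall>m\<ge>M. \<forall>n\<ge>M. dist (s m i) (s n i) < e" by blast
    qed
    hence "\<forall>i. \<exists>L. (\<lambda>n. s n i) \<longlonglongrightarrow> L" using Cauchy_convergent convergent_def by blast
    then obtain x where x: "\<And>i. (\<lambda>n. s n i) \<longlonglongrightarrow> x i" by metis
    \<comment> \<open>With \<open>n\<close> fixed, \<open>m\<close> tends to infinity in the Cauchy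
      estimate; finiteness of \<open>F\<close> lets the limit be taken term by term.\<close>
    have fin: "(\<Sum>i\<in>F. (cmod ((s n - x) i))\<^sup>2) \<le> e\<^sup>2"
      if F: "finite F" "F \<subseteq> I" and N: "\<And>m n. m \<ge> N \<Longrightarrow> n \<ge> N \<Longrightarrow> hnorm (ell2 I) (s m - s n) < e"
        and n: "n \<ge> N" for F N e n
    proof (rule LIMSEQ_le_const2)
      show "(\<lambda>m. \<Sum>i\<in>F. (cmod (s n i - s m i))\<^sup>2) \<longlonglongrightarrow> (\<Sum>i\<in>F. (cmod ((s n - x) i))\<^sup>2)"
        using x by (auto intro!: tendsto_intros)
      have "(\<Sum>i\<in>F. (cmod (s n i - s m i))\<^sup>2) \<le> e\<^sup>2" if "m \<ge> N" for m
      proof -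
        have "(\<Sum>i\<in>F. (cmod ((s n - s m) i))\<^sup>2) \<le> (\<Sum>\<^sub>\<infinity>i\<in>I. (cmod ((s n - s m) i))\<^sup>2)"
          using d[of n m] F by (intro finite_sum_le_infsum) (auto simp: ell2_carrier)
        also have "\<dots> = (hnorm (ell2 I) (s n - s m))\<^sup>2" by (simp add: ell2_norm_sq)
        also have "\<dots> \<le> e\<^sup>2"
        proof (rule power_mono)
          show "hnorm (ell2 I) (s n - s m) \<le> e" using N[OF n that] by simp
          show "0 \<le> hnorm (ell2 I) (s n - s m)"
            using ell2_coord_le[OF d, of n m undefined] norm_ge_zero order_trans by blast
        qed
        finally show ?thesis by simp
      qed
      thus "\<exists>N. \<forall>m\<ge>N. (\<Sum>i\<in>F. (cmod (s n i - s m i))\<^sup>2) \<le> e\<^sup>2" by blast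
    qed
    have x0: "x i = 0" if "i \<notin> I" for i
      using x[of i] s that by (simp add: ell2_carrier LIMSEQ_const_iff)
    have tail: "s n - x \<in> hcarrier (ell2 I) \<and> (hnorm (ell2 I) (s n - x))\<^sup>2 \<le> e\<^sup>2"
      if N: "\<And>m n. m \<ge> N \<Longrightarrow> n \<ge> N \<Longrightarrow> hnorm (ell2 I) (s m - s n) < e" and n: "n \<ge> N" for N e n
    proof -
      note f = fin[OF _ _ N n]
      have sm: "(\<lambda>i. (cmod ((s n - x) i))\<^sup>2) summable_on I"
        by (rule nonneg_bdd_above_summable_on) (auto intro!: bdd_aboveI2[where M="e\<^sup>2"] f[simplified])
      have "(\<Sum>\<^sub>\<infinity>i\<in>I. (cmod ((s n - x) i))\<^sup>2) \<le> e\<^sup>2"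
        by (rule infsum_le_finite_sums[OF sm f])
      thus ?thesis using sm x0 s[of n] by (simp add: ell2_norm_sq ell2_carrier)
    qed
    show "\<exists>x\<in>hcarrier (ell2 I). (\<lambda>n. hnorm (ell2 I) (s n - x)) \<longlonglongrightarrow> 0"
    proof (intro bexI)
      \<comment> \<open>One tail estimate, with tolerance 1, puts \<open>x\<close> into the space as
        \<open>s N - (s N - x)\<close>.\<close>
      obtain N where "\<And>m n. m \<ge> N \<Longrightarrow> n \<ge> N \<Longrightarrow> hnorm (ell2 I) (s m - s n) < 1"
        using C[rule_format, OF zero_less_one] by blast
      from tail[OF this order_refl] have "s N - x \<in> hcarrier (ell2 I)" by blast
      from subspace_diff[OF sub s[of N] this] show "x \<in> hcarrier (ell2 I)" by simp
      show "(\<lambda>n. hnorm (ell2 I) (s n - x)) \<longlonglongrightarrow> 0"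
      proof (rule LIMSEQ_I)
        fix e :: real assume e: "0 < e"
        then obtain N where N: "\<And>m n. m \<ge> N \<Longrightarrow> n \<ge> N \<Longrightarrow> hnorm (ell2 I) (s m - s n) < e / 2"
          using C[rule_format, OF half_gt_zero[OF e]] by blast
        have "norm (hnorm (ell2 I) (s n - x) - 0) < e" if "n \<ge> N" for n
        proof -
          have "\<bar>hnorm (ell2 I) (s n - x)\<bar> \<le> \<bar>e / 2\<bar>"
            using tail[OF N that] abs_le_square_iff by blast
          thus ?thesis using e by simp
        qed
        thus "\<exists>N. \<forall>n\<ge>N. norm (hnorm (ell2 I) (s n - x) - 0) < e" by blast
      qed
    qed
  qed
qed

text \<open>Finitely supported sequences with rational real and imaginary parts are dense; coding
  them by lists makes countability immediate.\<close>

lemma separable_ell2: "separable_hilbert (ell2 (UNIV :: nat set))"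
proof -
  let ?H = "ell2 (UNIV :: nat set)"
  define q where "q l = (\<lambda>i. if i < length l then Complex (of_rat (fst (l ! i))) (of_rat (snd (l ! i))) else 0)"
    for l :: "(rat \<times> rat) list"
  have fs: "z \<in> hcarrier ?H" if "\<And>i. i \<ge> n \<Longrightarrow> z i = 0" for z n
  proof -
    have "((\<lambda>i. (cmod (z i))\<^sup>2) has_sum (\<Sum>i<n. (cmod (z i))\<^sup>2)) UNIV"
      using that by (intro has_sum_finite_neutralI[of "{..<n}"]) auto
    thus ?thesis by (auto simp: ell2_carrier summable_on_def)
  qed
  have approx: "\<exists>a b :: rat. cmod (z - Complex (of_rat a) (of_rat b)) < e" if "e > 0" for z :: complex and e
  proof -
    obtain a where a: "Re z - e / 2 < of_rat a" "of_rat a < Re z"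
      using of_rat_dense[of "Re z - e / 2" "Re z"] \<open>e > 0\<close> by auto
    obtain b where b: "Im z - e / 2 < of_rat b" "of_rat b < Im z"
      using of_rat_dense[of "Im z - e / 2" "Im z"] \<open>e > 0\<close> by auto
    have "cmod (z - Complex (of_rat a) (of_rat b)) < e"
      using cmod_le[of "z - Complex (of_rat a) (of_rat b)"] a b by simp
    thus ?thesis by blast
  qed
  have "\<exists>d\<in>range q. hnorm ?H (x - d) < e" if x: "x \<in> hcarrier ?H" and e: "e > 0" for x e
  proof -
    define f where "f i = (cmod (x i))\<^sup>2" for i
    have fsum: "summable f"
      using x summable_on_UNIV_nonneg_real_iff[of f] unfolding f_def by (simp add: ell2_carrier)
    \<comment> \<open>The squared error is split evenly between the tail of \<open>x\<close> and its
      first \<open>n\<close> coordinates.\<close>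
    have "0 < e\<^sup>2 / 2" using e by simp
    from suminf_exist_split[OF this fsum]
    obtain n where "norm (suminf (\<lambda>i. f (i + n))) < e\<^sup>2 / 2" by blast
    hence n: "suminf (\<lambda>i. f (i + n)) < e\<^sup>2 / 2" by simp
    \<comment> \<open>The squares of \<open>n\<close> errors of this size sum to at most half of the
      squared tolerance; \<open>Suc n\<close> keeps the quotient positive for
      \<open>n = 0\<close>.\<close>
    define \<delta> where "\<delta> = e / (2 * real (Suc n))"
    have \<delta>: "\<delta> > 0" using e by (simp add: \<delta>_def)
    have "\<forall>i. \<exists>a b. cmod (x i - Complex (of_rat a) (of_rat b)) < \<delta>"
      by (intro allI approx[OF \<delta>])
    then obtain a b where ab: "\<And>i. cmod (x i - Complex (of_rat (a i)) (of_rat (b i))) < \<delta>"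
      by metis
    define d where "d = q (map (\<lambda>i. (a i, b i)) [0..<n])"
    have d_lt: "d i = Complex (of_rat (a i)) (of_rat (b i))" if "i < n" for i
      using that by (simp add: d_def q_def)
    have d_ge: "d i = 0" if "i \<ge> n" for i using that by (simp add: d_def q_def)
    define g where "g i = (cmod ((x - d) i))\<^sup>2" for i
    have gf: "g (i + n) = f (i + n)" for i by (simp add: f_def g_def d_ge)
    have gsum: "summable g"
      using fsum by (simp add: summable_iff_shift[of f n, symmetric] summable_iff_shift[of g n, symmetric] gf del: summable_iff_shift)
    have "norm (g i) = g i" for i by (simp add: g_def)
    hence "(g has_sum suminf g) UNIV"
      using gsum by (intro norm_summable_imp_has_sum) (simp_all add: summable_sums)
    hence "infsum g UNIV = suminf g" by (rule infsumI)
    hence "(hnorm ?H (x - d))\<^sup>2 = suminf g" by (simp add: ell2_norm_sq g_def[abs_def])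
    also have "\<dots> = suminf (\<lambda>i. g (i + n)) + (\<Sum>i<n. g i)"
      by (rule suminf_split_initial_segment[OF gsum])
    also have "suminf (\<lambda>i. g (i + n)) = suminf (\<lambda>i. f (i + n))" by (simp add: gf)
    also have "(\<Sum>i<n. g i) \<le> (\<Sum>i<n. \<delta>\<^sup>2)"
    proof (rule sum_mono)
      fix i assume "i \<in> {..<n}"
      thus "g i \<le> \<delta>\<^sup>2" unfolding g_def using ab[of i] by (intro power_mono) (simp_all add: d_lt)
    qed
    also have "(\<Sum>i<n. \<delta>\<^sup>2) \<le> e\<^sup>2 / 2"
    proof -
      have "real n * \<delta>\<^sup>2 = e\<^sup>2 * (real n / (4 * (real (Suc n))\<^sup>2))"
        by (simp add: \<delta>_def power_divide power_mult_distrib del: of_nat_Suc)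
      also have "\<dots> \<le> e\<^sup>2 * (1 / 2)"
        by (intro mult_left_mono) (auto simp: divide_simps power2_eq_square algebra_simps)
      finally show ?thesis by simp
    qed
    finally have "(hnorm ?H (x - d))\<^sup>2 < e\<^sup>2" using n by linarith
    hence "hnorm ?H (x - d) < e" using e by (intro power2_less_imp_less[of _ e]) auto
    thus ?thesis unfolding d_def by blast
  qed
  moreover have "range q \<subseteq> hcarrier ?H"
  proof
    fix z assume "z \<in> range q"
    then obtain l where "z = q l" by blast
    thus "z \<in> hcarrier ?H" by (intro fs[of "length l"]) (simp add: q_def)
  qed
  moreover have "countable (range q)" by blast
  ultimately show ?thesis unfolding separable_hilbert_def by blast
qed

section \<open>Four-diagonal unitary matrices\<close>

lemma sum_single:
  assumes "finite A" "a \<in> A" "\<And>k. k \<in> A \<Longrightarrow> k \<noteq> a \<Longrightarrow> f k = (0::'a::comm_monoid_add)"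
  shows "sum f A = f a"
  using sum.mono_neutral_right[of A "{a}" f] assms by auto

context complex_hilbert_space
begin

text \<open>The difference of the two sides lies in the span and is orthogonal to the vectors
  spanning it, hence to itself.\<close>

lemma orthonormal_span_expand:
  assumes on: "orthonormal K e" "finite K" and y: "y \<in> span (e ` K)"
  shows "y = (\<Sum>k\<in>K. ip y (e k) *\<^sub>H e k)"
proof -
  define z where "z = (\<Sum>k\<in>K. ip y (e k) *\<^sub>H e k)"
  have ek: "e k \<in> carr" if "k \<in> K" for k using orthonormal_mem[OF on(1) that] .
  have ec: "e ` K \<subseteq> carr" using ek by blast
  have yc: "y \<in> carr" using span_mem[OF ec y] .
  have zc: "z \<in> carr" unfolding z_def using ek by (intro sum_mem scale_mem)
  have "z \<in> span (e ` K)" unfolding z_def by (intro span_sum span_scale span_base imageI)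
  hence d: "y - z \<in> span (e ` K)" using y by (intro span_diff)
  have "ip (e k) (y - z) = 0" if "k \<in> K" for k
  proof -
    have "ip (y - z) (e k) = 0"
      using that ek yc zc orthonormal_comb_ip[OF on order_refl that, of "\<lambda>k. ip y (e k)"]
      by (simp add: ip_diff_left z_def)
    thus ?thesis using inner_commute[of "y - z" "e k"] yc zc ek that by simp
  qed
  hence "ip (y - z) (y - z) = 0"
    using yc zc by (intro span_orthogonal[OF ec _ _ d]) auto
  thus ?thesis using ip_self_eq_0[of "y - z"] yc zc unfolding z_def by simp
qed

text \<open>If the supports of two orthogonal columns (or rows) of a banded matrix meet in a single index,
  one of the two entries there vanishes.  If the subdiagonal has no zero, this kills first the entries
  \<open>c i (i + 2)\<close> and then the entries \<open>c i (i + 1)\<close>.  The first row is then \<open>(c 1 1, 0, 0, \<dots>)\<close>,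
  so \<open>c 1 1\<close> has modulus one, which forces \<open>c 2 1 = 0\<close>.\<close>

lemma subdiagonal_zero:
  fixes e :: "nat \<Rightarrow> 'v"
  assumes on: "orthonormal {1..} e"
    and T: "\<And>x y. x \<in> carr \<Longrightarrow> y \<in> carr \<Longrightarrow> ip (T x) (T y) = ip x y"
    and S: "\<And>x y. x \<in> carr \<Longrightarrow> y \<in> carr \<Longrightarrow> ip (S x) (S y) = ip x y"
    and col: "\<And>j. 1 \<le> j \<Longrightarrow> T (e j) = (\<Sum>k\<in>{1..j+4}. c k j *\<^sub>H e k)"
    and row: "\<And>i. 1 \<le> i \<Longrightarrow> S (e i) = (\<Sum>k\<in>{1..i+4}. cnj (c i k) *\<^sub>H e k)"
    and low: "\<And>i j. 1 \<le> i \<Longrightarrow> 1 \<le> j \<Longrightarrow> i > j + 1 \<Longrightarrow> c i j = 0"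
    and upp: "\<And>i j. 1 \<le> i \<Longrightarrow> 1 \<le> j \<Longrightarrow> j > i + 2 \<Longrightarrow> c i j = 0"
  shows "\<exists>n\<ge>1. c (n + 1) n = 0"
proof (rule ccontr)
  assume "\<not> ?thesis"
  hence sub: "c (n + 1) n \<noteq> 0" if "1 \<le> n" for n using that by blast
  have ek: "e k \<in> carr" if "1 \<le> k" for k using orthonormal_mem[OF on, of k] that by simp
  \<comment> \<open>The range up to \<open>j + 4\<close> contains the whole support of column
    \<open>j\<close>, so orthogonality of columns concerns finite sums.\<close>
  have cols: "(\<Sum>k\<in>{1..j+4} \<inter> {1..l+4}. c k j * cnj (c k l)) = (if j = l then 1 else 0)"
    if "1 \<le> j" "1 \<le> l" for j l
  proof -
    have "(\<Sum>k\<in>{1..j+4} \<inter> {1..l+4}. c k j * cnj (c k l)) = ip (T (e j)) (T (e l))"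
      unfolding col[OF that(1)] col[OF that(2)]
      by (rule orthonormal_comb_inner[OF on, symmetric]) auto
    also have "\<dots> = (if j = l then 1 else 0)"
      using T[OF ek ek] that orthonormal_ip[OF on, of j l] by simp
    finally show ?thesis .
  qed
  \<comment> \<open>\<open>S\<close> stands for the inverse, with the conjugate transpose as its
    matrix; its isometry yields the row relations.\<close>
  have rows: "(\<Sum>k\<in>{1..i+4} \<inter> {1..l+4}. cnj (c i k) * c l k) = (if i = l then 1 else 0)"
    if "1 \<le> i" "1 \<le> l" for i l
  proof -
    have "(\<Sum>k\<in>{1..i+4} \<inter> {1..l+4}. cnj (c i k) * cnj (cnj (c l k))) = ip (S (e i)) (S (e l))"
      unfolding row[OF that(1)] row[OF that(2)]
      by (rule orthonormal_comb_inner[OF on, symmetric]) auto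
    also have "\<dots> = (if i = l then 1 else 0)"
      using S[OF ek ek] that orthonormal_ip[OF on, of i l] by simp
    finally show ?thesis by simp
  qed
  \<comment> \<open>Column \<open>j\<close> ends in row \<open>j + 1\<close>, where column
    \<open>j + 3\<close> begins.\<close>
  have up2: "c (j + 1) (j + 3) = 0" if "1 \<le> j" for j
  proof -
    have "(\<Sum>k\<in>{1..j+4} \<inter> {1..(j+3)+4}. c k j * cnj (c k (j + 3))) = c (j + 1) j * cnj (c (j + 1) (j + 3))"
    proof (rule sum_single)
      fix k assume k: "k \<in> {1..j+4} \<inter> {1..(j+3)+4}" "k \<noteq> j + 1"
      hence "k > j + 1 \<or> j + 3 > k + 2" by auto
      thus "c k j * cnj (c k (j + 3)) = 0" using low[of k j] upp[of k "j + 3"] k(1) that by auto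
    qed auto
    thus ?thesis using cols[of j "j + 3"] sub[OF that] that by simp
  qed
  \<comment> \<open>Columns reach only rows from 2 on. In the first row the relation of rows 1 and 4
    takes over: they meet in column 3.\<close>
  have "c 1 3 = 0"
  proof -
    have "(\<Sum>k\<in>{1..1+4} \<inter> {1..4+4}. cnj (c 1 k) * c 4 k) = cnj (c 1 3) * c 4 3"
    proof (rule sum_single)
      fix k :: nat assume k: "k \<in> {1..1+4} \<inter> {1..4+4}" "k \<noteq> 3"
      hence "k > 1 + 2 \<or> 4 > k + 1" by auto
      thus "cnj (c 1 k) * c 4 k = 0" using low[of 4 k] upp[of 1 k] k(1) by auto
    qed auto
    thus ?thesis using rows[of 1 4] sub[of 3] by simp
  qed
  hence upp': "c i j = 0" if "1 \<le> i" "j > i + 1" for i j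
  proof (cases "j = i + 2")
    case True
    show ?thesis
    proof (cases "i = 1")
      case False
      thus ?thesis using up2[of "i - 1"] True that by (simp add: numeral_3_eq_3)
    qed (use \<open>c 1 3 = 0\<close> True in \<open>simp add: numeral_3_eq_3\<close>)
  qed (use upp[of i j] that in auto)
  \<comment> \<open>With the outer diagonal gone, column \<open>j + 2\<close> begins in row
    \<open>j + 1\<close>, and the argument repeats.\<close>
  have up1: "c (j + 1) (j + 2) = 0" if "1 \<le> j" for j
  proof -
    have "(\<Sum>k\<in>{1..j+4} \<inter> {1..(j+2)+4}. c k j * cnj (c k (j + 2))) = c (j + 1) j * cnj (c (j + 1) (j + 2))"
    proof (rule sum_single)
      fix k assume k: "k \<in> {1..j+4} \<inter> {1..(j+2)+4}" "k \<noteq> j + 1"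
      hence "k > j + 1 \<or> j + 2 > k + 1" by auto
      thus "c k j * cnj (c k (j + 2)) = 0" using low[of k j] upp'[of k "j + 2"] k(1) that by auto
    qed auto
    thus ?thesis using cols[of j "j + 2"] sub[OF that] that by simp
  qed
  have "c 1 2 = 0"
  proof -
    have "(\<Sum>k\<in>{1..1+4} \<inter> {1..3+4}. cnj (c 1 k) * c 3 k) = cnj (c 1 2) * c 3 2"
    proof (rule sum_single)
      fix k :: nat assume k: "k \<in> {1..1+4} \<inter> {1..3+4}" "k \<noteq> 2"
      hence "k > 1 + 1 \<or> 3 > k + 1" by auto
      thus "cnj (c 1 k) * c 3 k = 0" using low[of 3 k] upp'[of 1 k] k(1) by auto
    qed auto
    thus ?thesis using rows[of 1 3] sub[of 2] by simp
  qed
  have "(\<Sum>k\<in>{1..1+4} \<inter> {1..1+4}. cnj (c 1 k) * c 1 k) = cnj (c 1 1) * c 1 1"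
  proof (rule sum_single)
    fix k :: nat assume k: "k \<in> {1..1+4} \<inter> {1..1+4}" "k \<noteq> 1"
    hence "k = 2 \<or> k > 1 + 1" by auto
    thus "cnj (c 1 k) * c 1 k = 0" using upp'[of 1 k] \<open>c 1 2 = 0\<close> by auto
  qed auto
  hence row1: "cnj (c 1 1) * c 1 1 = 1" using rows[of 1 1] by simp
  have "(\<Sum>k\<in>{1..1+4} \<inter> {1..1+4}. c k 1 * cnj (c k 1)) = (\<Sum>k\<in>{1,2}. c k 1 * cnj (c k 1))"
  proof (rule sum.mono_neutral_right)
    show "\<forall>k\<in>{1..1+4} \<inter> {1..1+4} - {1, 2}. c k 1 * cnj (c k 1) = 0"
    proof
      fix k :: nat assume "k \<in> {1..1+4} \<inter> {1..1+4} - {1, 2}"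
      hence "k > 1 + 1" by auto
      thus "c k 1 * cnj (c k 1) = 0" using low[of k 1] by simp
    qed
  qed auto
  hence "c 1 1 * cnj (c 1 1) + c 2 1 * cnj (c 2 1) = 1" using cols[of 1 1] by simp
  hence "c 2 1 * cnj (c 2 1) = 0" using row1 by (simp add: mult.commute)
  thus False using sub[of 1] by (simp add: numeral_2_eq_2)
qed

end

text \<open>The \<open>d\<close>-th power of the bilateral shift on \<open>\<int>\<close>-indexed families, carried over to \<open>\<nat>\<close>.\<close>

definition shift :: "int \<Rightarrow> (nat \<Rightarrow> complex) \<Rightarrow> nat \<Rightarrow> complex" where
  "shift d x = (\<lambda>n. x (int_encode (int_decode n + d)))"

lemma shift_shift: "shift d (shift d' x) = shift (d + d') x"
  by (simp add: shift_def fun_eq_iff add.assoc)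
lemma shift_0: "shift 0 x = x"
  by (simp add: shift_def)

lemma shift_bij: "bij_betw (\<lambda>n. int_encode (int_decode n + d)) UNIV UNIV"
  by (rule bij_betw_byWitness[where f'="\<lambda>n. int_encode (int_decode n - d)"]) auto

lemma shift_carrier: "x \<in> hcarrier (ell2 UNIV) \<Longrightarrow> shift d x \<in> hcarrier (ell2 UNIV)"
  using summable_on_reindex_bij_betw[OF shift_bij[of d], of "\<lambda>i. (cmod (x i))\<^sup>2"]
  by (simp add: ell2_carrier shift_def)

lemma shift_inner: "hinner (ell2 UNIV) (shift d x) (shift d y) = hinner (ell2 UNIV) x y"
  using infsum_reindex_bij_betw[OF shift_bij[of d], of "\<lambda>i. x i * cnj (y i)"]
  by (simp add: ell2_inner shift_def)

lemma shift_linear: "linear_map_on (ell2 UNIV) (ell2 UNIV) (shift d)"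
  unfolding linear_map_on_def by (auto simp: shift_carrier) (auto simp: shift_def ell2_scale)

lemma shift_unitary: "unitary_operator (ell2 UNIV) (shift d)"
  unfolding unitary_map_def
proof (intro conjI ballI)
  show "shift d ` hcarrier (ell2 UNIV) = hcarrier (ell2 UNIV)"
  proof (intro antisym subsetI)
    fix x :: "nat \<Rightarrow> complex" assume "x \<in> hcarrier (ell2 UNIV)"
    hence "shift (- d) x \<in> hcarrier (ell2 UNIV)" by (rule shift_carrier)
    moreover have "x = shift d (shift (- d) x)" by (simp add: shift_shift shift_0)
    ultimately show "x \<in> shift d ` hcarrier (ell2 UNIV)" by blast
  qed (auto intro: shift_carrier)
qed (simp_all add: shift_linear shift_inner)

interpretation l2: complex_hilbert_space "ell2 (UNIV :: nat set)"
  by (rule complex_hilbert_space_ell2)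

lemma l2_sum_apply: "(\<Sum>k\<in>K. hscale (ell2 UNIV) (a k) (e k)) n = (\<Sum>k\<in>K. a k * e k n)"
  by (induction K rule: infinite_finite_induct) (auto simp: ell2_scale)

text \<open>The unit ball of a finite-dimensional subspace is bounded by a sequence tending to zero,
  whereas the shift moves a nonzero entry arbitrarily far out.\<close>

lemma shift_no_finite_invariant:
  assumes on: "l2.orthonormal K e" and K: "finite K" "K \<noteq> {}" and d: "d \<noteq> 0"
    and inv: "\<And>k. k \<in> K \<Longrightarrow> shift d (e k) \<in> l2.span (e ` K)"
  shows False
proof -
  obtain k0 where k0: "k0 \<in> K" using K by blast
  note ek = l2.orthonormal_mem[OF on]
  have n1: "hnorm (ell2 UNIV) (e k) = 1" if "k \<in> K" for k
    using l2.orthonormal_ip[OF on that that] by (simp add: hnorm_def)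
  have ec: "e ` K \<subseteq> hcarrier (ell2 UNIV)" using ek by blast
  have img: "shift d ` (e ` K) \<subseteq> l2.span (e ` K)" using inv by blast
  have pow: "shift (int m * d) (e k0) \<in> l2.span (e ` K)" for m
  proof (induction m)
    case (Suc m)
    have "shift d (shift (int m * d) (e k0)) \<in> l2.span (e ` K)"
      by (rule l2.linear_span_image[OF shift_linear ec img Suc])
    thus ?case by (simp add: shift_shift algebra_simps)
  qed (use k0 in \<open>auto simp: shift_0 intro: l2.span_base\<close>)
  \<comment> \<open>By Cauchy-Schwarz the coefficients of a unit vector have modulus at most 1, so
    \<open>t\<close> dominates every unit vector in the span.\<close>
  define t where "t n = (\<Sum>k\<in>K. cmod (e k n))" for n
  have bound: "cmod (shift (int m * d) (e k0) n) \<le> t n" for m n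
  proof -
    let ?y = "shift (int m * d) (e k0)"
    have y: "?y \<in> hcarrier (ell2 UNIV)" using ek[OF k0] by (rule shift_carrier)
    have ny: "hnorm (ell2 UNIV) ?y = 1" using n1[OF k0] by (simp add: hnorm_def shift_inner)
    have "?y n = (\<Sum>k\<in>K. hinner (ell2 UNIV) ?y (e k) * e k n)"
      using fun_cong[OF l2.orthonormal_span_expand[OF on K(1) pow[of m]], of n]
      unfolding l2_sum_apply .
    also have "cmod \<dots> \<le> (\<Sum>k\<in>K. cmod (hinner (ell2 UNIV) ?y (e k)) * cmod (e k n))"
      by (rule order_trans[OF norm_sum]) (simp add: norm_mult)
    also have "\<dots> \<le> (\<Sum>k\<in>K. 1 * cmod (e k n))"
    proof (intro sum_mono mult_right_mono)
      fix k assume "k \<in> K"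
      thus "cmod (hinner (ell2 UNIV) ?y (e k)) \<le> 1"
        using l2.cauchy_schwarz[OF y ek[of k]] n1[of k] ny by simp
    qed simp
    finally show ?thesis by (simp add: t_def)
  qed
  have tlim: "t \<longlonglongrightarrow> 0"
    unfolding t_def
  proof (rule tendsto_null_sum)
    fix k assume "k \<in> K"
    hence "(\<lambda>n. (cmod (e k n))\<^sup>2) summable_on UNIV" using ek[of k] by (simp add: ell2_carrier)
    hence "summable (\<lambda>n. (cmod (e k n))\<^sup>2)" by (rule summable_on_imp_summable)
    hence "(\<lambda>n. (cmod (e k n))\<^sup>2) \<longlonglongrightarrow> 0" by (rule summable_LIMSEQ_zero)
    from tendsto_real_sqrt[OF this] show "(\<lambda>n. cmod (e k n)) \<longlonglongrightarrow> 0" by simp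
  qed
  have "e k0 \<noteq> 0" using n1[OF k0] l2.nm_eq_0[OF ek[OF k0]] by auto
  then obtain n0 where n0: "e k0 n0 \<noteq> 0" by (auto simp: fun_eq_iff)
  \<comment> \<open>At position \<open>g m\<close> the shift by \<open>int m * d\<close> shows the
    entry \<open>e k0 n0\<close>; the minus sign compensates for \<open>shift\<close> reading at the
    displaced index.\<close>
  define g where "g m = int_encode (int_decode n0 - int m * d)" for m :: nat
  have "t (g m) \<ge> cmod (e k0 n0)" for m
    using bound[of m "g m"] by (simp add: g_def shift_def)
  moreover have "finite {n. t n \<ge> cmod (e k0 n0)}"
  proof -
    have "eventually (\<lambda>n. t n < cmod (e k0 n0)) sequentially"
      using order_tendstoD(2)[OF tlim, of "cmod (e k0 n0)"] n0 by simp
    then obtain N where "\<And>n. n \<ge> N \<Longrightarrow> t n < cmod (e k0 n0)" by (auto simp: eventually_sequentially)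
    hence "{n. t n \<ge> cmod (e k0 n0)} \<subseteq> {..<N}" by (metis lessThan_iff linorder_not_le mem_Collect_eq subsetI)
    thus ?thesis using finite_subset by blast
  qed
  ultimately have "finite (range g)" by (auto intro: finite_subset[rotated])
  moreover have "inj g" using d by (auto simp: g_def inj_on_def int_encode_eq)
  ultimately show False using range_inj_infinite by blast
qed

text \<open>A general exponent \<open>d\<close> lets one statement serve the shift and its inverse,
  which trade places under conjugate transposition. A finite block is itself an invariant subspace
  of finite dimension.\<close>

lemma shift_not_hessenberg_banded:
  fixes e :: "nat \<Rightarrow> nat \<Rightarrow> complex"
  assumes I: "matrix_index_set I" and on: "l2.orthonormal I e" and d: "d \<noteq> 0"
    and col: "\<And>j. j \<in> I \<Longrightarrow> shift d (e j) = (\<Sum>k\<in>I \<inter> {..j+4}. hscale (ell2 UNIV) (c k j) (e k))"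
    and row: "\<And>i. i \<in> I \<Longrightarrow> shift (- d) (e i) = (\<Sum>k\<in>I \<inter> {..i+4}. hscale (ell2 UNIV) (cnj (c i k)) (e k))"
    and pq: "pq_diagonal 1 2 I c"
  shows False
proof -
  have low: "c i j = 0" if "i \<in> I" "j \<in> I" "i > j + 1" for i j
    using pq that unfolding pq_diagonal_def by auto
  have upp: "c i j = 0" if "i \<in> I" "j \<in> I" "j > i + 2" for i j
    using pq that unfolding pq_diagonal_def by auto
  from I consider "I = {1..}" | N where "N \<ge> 1" "I = {1..N}"
    unfolding matrix_index_set_def by blast
  thus False
  proof cases
    case 1
    have eq: "I \<inter> {..j + 4} = {1..j + 4}" for j using 1 by auto
    have "\<exists>n\<ge>1. c (n + 1) n = 0"
    proof (rule l2.subdiagonal_zero[where T="shift d" and S="shift (- d)"])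
      show "l2.orthonormal {1..} e" using on 1 by simp
      show "shift d (e j) = (\<Sum>k\<in>{1..j+4}. hscale (ell2 UNIV) (c k j) (e k))" if "1 \<le> j" for j
        using col[of j] that 1 unfolding eq by simp
      show "shift (- d) (e i) = (\<Sum>k\<in>{1..i+4}. hscale (ell2 UNIV) (cnj (c i k)) (e k))" if "1 \<le> i" for i
        using row[of i] that 1 unfolding eq by simp
    qed (use low upp 1 in \<open>auto simp: shift_inner\<close>)
    then obtain n where n: "n \<ge> 1" "c (n + 1) n = 0" by blast
    show False
    proof (rule shift_no_finite_invariant[OF _ _ _ d])
      show "l2.orthonormal {1..n} e" using l2.orthonormal_subset[OF on] 1 by auto
      fix j assume j: "j \<in> {1..n}"
      have "hscale (ell2 UNIV) (c k j) (e k) \<in> l2.span (e ` {1..n})" if "k \<in> I \<inter> {..j+4}" for k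
      proof (cases "k \<le> n")
        case True
        thus ?thesis using that 1 by (intro l2.span_scale l2.span_base) auto
      next
        case False
        \<comment> \<open>A column \<open>j < n\<close> ends in row \<open>j + 1\<close>, which is
          at most \<open>n\<close>; only column \<open>n\<close> could reach row
          \<open>n + 1\<close>, where its entry is the zero just found.\<close>
        hence "c k j = 0" using n low[of k j] j that 1 by (cases "j = n \<and> k = n + 1") auto
        thus ?thesis by (simp add: l2.span_zero)
      qed
      thus "shift d (e j) \<in> l2.span (e ` {1..n})"
        using col[of j] l2.span_sum[of "I \<inter> {..j+4}"] j 1 by simp
    qed (use n in auto)
  next
    case 2
    show False
    proof (rule shift_no_finite_invariant[OF on _ _ d])
      fix j assume j: "j \<in> I"
      show "shift d (e j) \<in> l2.span (e ` I)"
        unfolding col[OF j] by (intro l2.span_sum l2.span_scale l2.span_base) auto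
    qed (use 2 in auto)
  qed
qed

section \<open>Extracting a block from a representation\<close>

context hilbert_unitary
begin

text \<open>One block is pulled back to \<open>H\<close>; a nonzero vector guarantees that there is
  a block at all. The range up to \<open>j + n\<close> is a crude bound valid for both shapes of an
  \<open>n\<close>-diagonal matrix and is the origin of the constant 4 in the preceding
  lemmas.\<close>

lemma representation_block:
  assumes rep: "has_n_diagonal_representation n H U" and nz: "x0 \<in> carr" "x0 \<noteq> 0"
  obtains I e c where "matrix_index_set I" "orthonormal I e" "n_diagonal n I c"
    "\<And>j. j \<in> I \<Longrightarrow> U (e j) = (\<Sum>k\<in>I \<inter> {..j+n}. c k j *\<^sub>H e k)"
    "\<And>i. i \<in> I \<Longrightarrow> Uinv (e i) = (\<Sum>k\<in>I \<inter> {..i+n}. cnj (c i k) *\<^sub>H e k)"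
proof -
  obtain J :: "nat set" and I A V where
    blocks: "\<And>j. j \<in> J \<Longrightarrow> matrix_index_set (I j) \<and> (\<exists>c. n_diagonal n (I j) c \<and> given_by_matrix (I j) c (A j))"
    and V: "unitary_map H (hilbert_sum J (\<lambda>j. ell2 (I j))) V"
    and VU: "\<And>x. x \<in> carr \<Longrightarrow> V (U x) = operator_sum J A (V x)"
    using rep unfolding has_n_diagonal_representation_def unitarily_equivalent_def by blast
  let ?L = "hilbert_sum J (\<lambda>j. ell2 (I j))"
  have Vip: "hinner ?L (V x) (V y) = ip x y" if "x \<in> carr" "y \<in> carr" for x y
    using V that unfolding unitary_map_def by blast
  have Vadd: "V (x + y) = V x + V y" if "x \<in> carr" "y \<in> carr" for x y
    using V that unfolding unitary_map_def linear_map_on_def by blast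
  have Vscale: "V (a *\<^sub>H x) = hscale ?L a (V x)" if "x \<in> carr" for a x
    using V that unfolding unitary_map_def linear_map_on_def by blast
  have Vim: "V ` carr = hcarrier ?L"
    using V unfolding unitary_map_def by blast
  have Vinj: "x = y" if "x \<in> carr" "y \<in> carr" "V x = V y" for x y
    using that Vip by (intro ip_ext) metis+
  have V0: "V 0 = 0" using Vadd[of 0 0] by simp
  have "J \<noteq> {}"
  proof
    assume "J = {}"
    hence "hcarrier ?L \<subseteq> {0}" by (auto simp: hilbert_sum_def fun_eq_iff)
    hence "V x0 = 0" using Vim nz(1) by blast
    thus False using Vinj[of x0 0] nz V0 by simp
  qed
  then obtain j0 where j0: "j0 \<in> J" by blast
  define B where "B = I j0"
  obtain c where mB: "matrix_index_set B" and c: "n_diagonal n B c" "given_by_matrix B c (A j0)"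
    using blocks[OF j0] unfolding B_def by blast
  define emb where "emb y = (\<lambda>j. if j = j0 then y else 0)" for y :: "nat \<Rightarrow> complex"
  have ell0: "hinner (ell2 S) x 0 = 0" "hnorm (ell2 S) 0 = 0" for S :: "nat set" and x
    by (simp_all add: ell2_inner hnorm_def)
  have emb_in: "emb y \<in> hcarrier ?L" if y: "y \<in> hcarrier (ell2 B)" for y
  proof -
    have "((\<lambda>j. (hnorm (ell2 (I j)) (emb y j))\<^sup>2) has_sum (hnorm (ell2 B) y)\<^sup>2) J"
      using j0 by (intro has_sum_finite_neutralI[of "{j0}"]) (auto simp: emb_def B_def ell0)
    hence "(\<lambda>j. (hnorm (ell2 (I j)) (emb y j))\<^sup>2) summable_on J" by (auto simp: summable_on_def)
    thus ?thesis using y j0 by (auto simp: hilbert_sum_def emb_def B_def ell2_carrier)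
  qed
  have emb_inner: "hinner ?L z (emb y) = hinner (ell2 B) (z j0) y" for z y
  proof -
    have "((\<lambda>j. hinner (ell2 (I j)) (z j) (emb y j)) has_sum hinner (ell2 B) (z j0) y) J"
      using j0 by (intro has_sum_finite_neutralI[of "{j0}"]) (auto simp: emb_def B_def ell0)
    thus ?thesis by (simp add: hilbert_sum_def infsumI)
  qed
  define inV where "inV y = inv_into carr V (emb y)" for y
  have inV: "inV y \<in> carr" "V (inV y) = emb y" if "y \<in> hcarrier (ell2 B)" for y
    using emb_in[OF that] Vim unfolding inV_def by (metis inv_into_into, metis f_inv_into_f)
  define e where "e i = inV (canonical_vec i)" for i
  have e: "e i \<in> carr" "V (e i) = emb (canonical_vec i)" if "i \<in> B" for i
    unfolding e_def using inV canonical_vec_carrier[OF that] by blast+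
  have on: "orthonormal B e"
    unfolding orthonormal_def
  proof (intro conjI ballI)
    fix i k assume ik: "i \<in> B" "k \<in> B"
    have "ip (e i) (e k) = hinner ?L (V (e i)) (V (e k))" using Vip e(1) ik by simp
    also have "\<dots> = canonical_vec i k"
      using e(2) ik by (simp add: emb_inner ell2_inner_canonical) (simp add: emb_def)
    finally show "ip (e i) (e k) = (if i = k then 1 else 0)" by (simp add: canonical_vec_def)
  qed (rule e(1))
  have V_comb: "V (\<Sum>k\<in>F. a k *\<^sub>H e k) = emb (\<lambda>i. if i \<in> F then a i else 0)"
    if "finite F" "F \<subseteq> B" for F a
    using that
  proof (induction F rule: finite_induct)
    case empty thus ?case by (simp add: V0) (simp add: emb_def fun_eq_iff)
  next
    case (insert k F)
    have s: "(\<Sum>k\<in>F. a k *\<^sub>H e k) \<in> carr" using insert.prems e(1) by (intro sum_mem scale_mem) auto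
    have "V (\<Sum>k\<in>insert k F. a k *\<^sub>H e k) = hscale ?L (a k) (emb (canonical_vec k)) + emb (\<lambda>i. if i \<in> F then a i else 0)"
      using insert e s by (simp add: Vadd Vscale)
    also have "\<dots> = emb (\<lambda>i. if i \<in> insert k F then a i else 0)"
      using insert.hyps by (auto simp: hilbert_sum_def emb_def fun_eq_iff canonical_vec_def ell2_scale)
    finally show ?case .
  qed
  have bd: "bounded_operator (ell2 (I j)) (A j)" if "j \<in> J" for j
    using blocks[OF that] unfolding given_by_matrix_def by blast
  have A0: "A j 0 = 0" if "j \<in> J" for j
  proof -
    have "A j (hscale (ell2 (I j)) 0 0) = hscale (ell2 (I j)) 0 (A j 0)"
      using bd[OF that] unfolding bounded_operator_def linear_map_on_def by (simp add: ell2_carrier)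
    thus ?thesis by (simp add: ell2_scale zero_fun_def)
  qed
  have T_emb: "operator_sum J A (emb y) = emb (A j0 y)" for y
    using A0 j0 by (auto simp: operator_sum_def emb_def fun_eq_iff)
  have Ac: "A j0 y \<in> hcarrier (ell2 B)" if "y \<in> hcarrier (ell2 B)" for y
    using bd[OF j0] that unfolding bounded_operator_def linear_map_on_def B_def by blast
  have Aentry: "A j0 (canonical_vec j) i = c i j" if "i \<in> B" "j \<in> B" for i j
    using c(2) that ell2_inner_canonical[OF that(1), of "A j0 (canonical_vec j)"]
    unfolding given_by_matrix_def by simp
  have band: "c i j = 0" if "i \<in> B" "j \<in> B" "i > j + n \<or> j > i + n" for i j
  proof -
    have "int i - int j > int (n div 2)" if "i > j + n" using that by linarith
    moreover have "int i - int j > int ((n - 1) div 2)" if "i > j + n" using that by linarith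
    moreover have "int j - int i > int (n div 2)" if "j > i + n" using that by linarith
    moreover have "int j - int i > int ((n - 1) div 2)" if "j > i + n" using that by linarith
    ultimately show ?thesis using c(1) that unfolding n_diagonal_def pq_diagonal_def by blast
  qed
  have U_e: "U (e j) = (\<Sum>k\<in>B \<inter> {..j+n}. c k j *\<^sub>H e k)" if j: "j \<in> B" for j
  proof (rule Vinj)
    show "U (e j) \<in> carr" using e(1)[OF j] by simp
    show "(\<Sum>k\<in>B \<inter> {..j+n}. c k j *\<^sub>H e k) \<in> carr" using e(1) by (intro sum_mem scale_mem) auto
    have "A j0 (canonical_vec j) = (\<lambda>i. if i \<in> B \<inter> {..j+n} then c i j else 0)"
    proof
      fix i
      show "A j0 (canonical_vec j) i = (if i \<in> B \<inter> {..j+n} then c i j else 0)"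
        using Aentry[OF _ j, of i] band[OF _ j, of i] Ac[OF canonical_vec_carrier[OF j]]
        by (cases "i \<in> B") (auto simp: ell2_carrier)
    qed
    thus "V (U (e j)) = V (\<Sum>k\<in>B \<inter> {..j+n}. c k j *\<^sub>H e k)"
      using VU[OF e(1)[OF j]] e(2)[OF j] V_comb[of "B \<inter> {..j+n}" "\<lambda>k. c k j"] by (simp add: T_emb)
  qed
  have c_ip: "c k j = ip (U (e j)) (e k)" if "j \<in> B" "k \<in> B" for j k
    using orthonormal_comb_ip[OF on, of "B \<inter> {..j+n}" k "\<lambda>k. c k j"] U_e[OF that(1)] band[OF that(2,1)] that
    by auto
  have Ui_e: "Uinv (e i) = (\<Sum>k\<in>B \<inter> {..i+n}. cnj (c i k) *\<^sub>H e k)" if i: "i \<in> B" for i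
  proof (rule Vinj)
    show Uic: "Uinv (e i) \<in> carr" using e(1)[OF i] by simp
    show "(\<Sum>k\<in>B \<inter> {..i+n}. cnj (c i k) *\<^sub>H e k) \<in> carr" using e(1) by (intro sum_mem scale_mem) auto
    \<comment> \<open>The component \<open>y\<close> in block \<open>j0\<close> turns out to be all
      of \<open>V (Uinv (e i))\<close>: \<open>U\<close> maps its pullback to \<open>e i\<close>, so
      that pullback is \<open>Uinv (e i)\<close>.\<close>
    define y where "y = V (Uinv (e i)) j0"
    have yB: "y \<in> hcarrier (ell2 B)"
      using Vim Uic j0 unfolding y_def B_def by (auto simp: hilbert_sum_def)
    have T: "operator_sum J A (V (Uinv (e i))) = emb (canonical_vec i)"
      using VU[OF Uic] e[OF i] by simp
    have "A j0 y = canonical_vec i"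
      using fun_cong[OF T, of j0] j0 by (simp add: operator_sum_def emb_def y_def)
    hence "V (U (inV y)) = V (e i)" using VU[OF inV(1)[OF yB]] inV(2)[OF yB] e(2)[OF i] by (simp add: T_emb)
    hence "U (inV y) = e i" using Vinj inV(1)[OF yB] e(1)[OF i] by simp
    hence "inV y = Uinv (e i)" using Uinv_U[OF inV(1)[OF yB]] by simp
    hence VUi: "V (Uinv (e i)) = emb y" using inV(2)[OF yB] by simp
    have "y k = cnj (c i k)" if k: "k \<in> B" for k
    proof -
      have "y k = hinner ?L (V (Uinv (e i))) (V (e k))"
        using e(2)[OF k] ell2_inner_canonical[OF k] by (simp add: emb_inner y_def)
      also have "\<dots> = ip (e i) (U (e k))" using Vip Uic e(1) i k by (simp add: Uinv_adjoint)
      also have "\<dots> = cnj (c i k)" using inner_commute[of "U (e k)" "e i"] e(1) i k by (simp add: c_ip)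
      finally show ?thesis .
    qed
    hence "y k = (if k \<in> B \<inter> {..i+n} then cnj (c i k) else 0)" for k
      using yB band[OF i, of k] by (cases "k \<in> B") (auto simp: ell2_carrier)
    hence "y = (\<lambda>k. if k \<in> B \<inter> {..i+n} then cnj (c i k) else 0)" by blast
    thus "V (Uinv (e i)) = V (\<Sum>k\<in>B \<inter> {..i+n}. cnj (c i k) *\<^sub>H e k)"
      using VUi V_comb[of "B \<inter> {..i+n}" "\<lambda>k. cnj (c i k)"] by simp
  qed
  show ?thesis using that[OF mB on c(1) U_e Ui_e] by blast
qed

end

lemma shift_not_four_diagonal: "\<not> has_n_diagonal_representation 4 (ell2 UNIV) (shift 1)"
proof
  assume rep: "has_n_diagonal_representation 4 (ell2 UNIV) (shift 1)"
  interpret hilbert_unitary "ell2 UNIV" "shift 1"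
    by unfold_locales (rule shift_unitary)
  have cv: "canonical_vec 0 \<in> hcarrier (ell2 (UNIV :: nat set))"
    by (simp add: canonical_vec_carrier)
  have nz: "canonical_vec 0 \<noteq> (0 :: nat \<Rightarrow> complex)"
    by (auto simp: canonical_vec_def fun_eq_iff)
  obtain I e c where I: "matrix_index_set I" and on: "l2.orthonormal I e" and c: "n_diagonal 4 I c"
    and col: "\<And>j. j \<in> I \<Longrightarrow> shift 1 (e j) = (\<Sum>k\<in>I \<inter> {..j+4}. hscale (ell2 UNIV) (c k j) (e k))"
    and row: "\<And>i. i \<in> I \<Longrightarrow> Uinv (e i) = (\<Sum>k\<in>I \<inter> {..i+4}. hscale (ell2 UNIV) (cnj (c i k)) (e k))"
    using representation_block[OF rep cv nz] by blast
  have "Uinv x = shift (- 1) x" if "x \<in> hcarrier (ell2 UNIV)" for x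
    using Uinv_U[OF shift_carrier[OF that, of "- 1"]] by (simp add: shift_shift shift_0)
  hence row': "shift (- 1) (e i) = (\<Sum>k\<in>I \<inter> {..i+4}. hscale (ell2 UNIV) (cnj (c i k)) (e k))"
    if "i \<in> I" for i
    using row[OF that] l2.orthonormal_mem[OF on that] by simp
  from c consider "pq_diagonal 2 1 I c" | "pq_diagonal 1 2 I c" by (auto simp: n_diagonal_def)
  thus False
  proof cases
    case 1
    \<comment> \<open>The inverse shift has the conjugate transpose as its matrix, which is
      (1,2)-diagonal; \<open>row'\<close> and \<open>col\<close> exchange roles.\<close>
    show False
    proof (rule shift_not_hessenberg_banded[OF I on, of "- 1" "\<lambda>i j. cnj (c j i)"])
      show "pq_diagonal 1 2 I (\<lambda>i j. cnj (c j i))" using 1 by (auto simp: pq_diagonal_def)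
    qed (use row' col in auto)
  next
    case 2
    show False by (rule shift_not_hessenberg_banded[OF I on _ col row' 2]) simp_all
  qed
qed

theorem corollary3p10:
  shows "(\<forall>(H :: 'v::ab_group_add hilbert) U.
            complex_hilbert_space H \<and> separable_hilbert H \<and> unitary_operator H U
              \<longrightarrow> has_n_diagonal_representation 5 H U)
       \<and> \<not> (\<forall>(H :: (nat \<Rightarrow> complex) hilbert) U.
            complex_hilbert_space H \<and> separable_hilbert H \<and> unitary_operator H U
              \<longrightarrow> has_n_diagonal_representation 4 H U)"
proof (rule conjI)
  show "\<forall>(H :: 'v::ab_group_add hilbert) U.
      complex_hilbert_space H \<and> separable_hilbert H \<and> unitary_operator H U
        \<longrightarrow> has_n_diagonal_representation 5 H U"
    by (auto intro!: hilbert_unitary.five_diagonal_representation hilbert_unitary.intro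
        hilbert_unitary_axioms.intro)
  show "\<not> (\<forall>(H :: (nat \<Rightarrow> complex) hilbert) U.
      complex_hilbert_space H \<and> separable_hilbert H \<and> unitary_operator H U
        \<longrightarrow> has_n_diagonal_representation 4 H U)"
    using complex_hilbert_space_ell2 separable_ell2 shift_unitary shift_not_four_diagonal by blast
qed

end
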